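(* Let $\{x^k\}$ be a sequence generated by the BPIREe-$\ell_p$ algorithm described in the context ($0<p<1$), with stepsizes and extrapolation parameters as in the context, and suppose that Assumptions 1, 2, 3 and 4 of the context hold. Let $x^*$ be a limit point of $\{x^k\}$, and suppose that for some $\rho>0$ and for each block $s_i$ the map $x\mapsto\nabla_{s_i}f(x)$ is Lipschitz continuous with respect to $x$ on $B_{4\rho}(x^* )=\{x:\|x-x^*\|<4\rho\}$, i.e. there is $L_G$ with $\|\nabla_{s_i}f(y)-\nabla_{s_i}f(z)\|\le L_G\|y-z\|$ for all $y,z\in B_{4\rho}(x^* )$. Then $$\lim_{k\to+\infty}x^k=x^*.$$
   Context: Problem. Let $\{s_1,\dots,s_m\}$ be a partition of $\{1,\dots,n\}$ into disjoint blocks; $x_{s_i}$ is the subvector of $x\in\mathbb{R}^n$ indexed by $s_i$, $\nabla_{s_i}f$ the partial gradient, and $(x_{\neq s_i},y_{s_i})$ is $x$ with block $s_i$ replaced by $y_{s_i}$. Let $0<p<1$, $\lambda>0$ and $$F(x,\varepsilon)=f(x)+\lambda\sum_{j=1}^n(|x_j|+\varepsilon_j^2)^p,\qquad x,\varepsilon\in\mathbb{R}^n,$$ a smoothing of the $\ell_p$-regularized problem $\min_x f(x)+\lambda\sum_j|x_j|^p$. Assumption 1 (for this model). $f:\mathbb{R}^n\to\mathbb{R}$ is continuously differentiable and, for each block, its partial gradient is Lipschitz in that block when the other blocks are fixed, with Lipschitz constants in $[\ell,L]$ for some $0<\ell\le L<\infty$; and the objective is coercive in $x$ ($F(x,\varepsilon)\to+\infty$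 as $\|x\|\to+\infty$). BPIREe-$\ell_p$ algorithm. Start from $x^{-1}=x^0$ and $\varepsilon^0$ with all entries positive; fix $\mu\in(0,1)$. At iteration $k=1,2,\dots$ choose a block $b_k\in\{s_1,\dots,s_m\}$. Set $x^k_{s_i}=x^{k-1}_{s_i}$ if $s_i\neq b_k$, and for $s_i=b_k$ $$x^k_{s_i}=\arg\min_{x_{s_i}}\Big\{\langle\nabla_{s_i}f(x^{k-1}_{\neq s_i},\hat x^k_{s_i}),x_{s_i}\rangle+\tfrac1{2\alpha_k}\|x_{s_i}-\hat x^k_{s_i}\|^2+\lambda\sum_{j\in s_i}w^{k-1}_j|x_j|\Big\},$$ where $w^{k-1}_j=p(|x^{k-1}_j|+(\varepsilon^{k-1}_j)^2)^{p-1}$, $\hat x^k_{s_i}=x^{k-1}_{s_i}+\beta_k(x^{k-1}_{s_i}-x^{\rm prev}_{s_i})$, $0\le\beta_k\le1$, and $x^{\rm prev}_{s_i}$ is the value of block $s_i$ just before its most recent update prior to iteration $k$ (equal to $x^0_{s_i}$ if it was never updated before). The smoothing parameters (kept positive) are updated by: $\varepsilon^{k+1}_i=\varepsilon^k_i$ if $x^{k+1}_i=0$, and $0<\varepsilon^{k+1}_i\le\sqrt\mu\,\varepsilon^k_i$ if $x^{k+1}_i\neq0$. Parameters. $L_k\in[\ell,L]$ is a Lipschitz constant of $y\mapsto\nabla_{b_k}f(x^{k-1}_{\neq b_k},y)$; $\tilde L^j_{s_i},\tilde\beta^j_{s_i}$ denote $L_k,\beta_k$ at the iteration $k$ at which block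 $s_i$ gets its $j$th update ($\tilde L^0_{s_i}$ is any fixed number in $[\ell,L]$). Then $\alpha_k=\frac1{2L_k}$ and $\tilde\beta^j_{s_i}\le\frac\delta6\sqrt{\tilde L^{j-1}_{s_i}/\tilde L^j_{s_i}}$ for a fixed $\delta\in[0,1)$. Assumption 2. There is an integer $T\ge m$ such that every block is updated at least once within any $T$ consecutive iterations. Assumption 3. For every $k\ge1$, $\beta_k$ is chosen so that $F(x^k,\varepsilon^k)\le F(x^{k-1},\varepsilon^{k-1})$. Reduced function. For $x\in\mathbb{R}^n$ let $\mathcal I(x)=\{i:x_i\ne0\}$. For sequences generated by the algorithm, $\mathcal I(x^k)$ is the same set $\mathcal I^*$ for all sufficiently large $k$, and $\mathcal I(x^* )=\mathcal I^*$ for every limit point $x^*$. The reduced function is $(x_{\mathcal I^*},\varepsilon_{\mathcal I^*})\mapsto F(x_{\mathcal I^*},\varepsilon_{\mathcal I^*})=f(x_{\mathcal I^*})+\lambda\sum_{j\in\mathcal I^*}(|x_j|+\varepsilon_j^2)^p$ on $\mathbb{R}^{2|\mathcal I^*|}$, where $f(x_{\mathcal I^*})$ means $f$ evaluated with all coordinates outside $\mathcal I^*$ equal to $0$. Assumption 4. The reduced function has the KL property at every $(x^*_{\mathcal I^*},0_{\mathcal I^*})\in\mathbb{R}^{2|\mathcal I^*|}$, where $x^*$ is a limit point of the sequence generated by the algorithm. KL property. $\partial$ denotes the limiting subdifferential. A proper closed $J$ has the Kurdyka-Łojasiewicz (KL) property at $\bar x\in\mathrm{dom}\,\partial J$ if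 there are a neighborhood $U$ of $\bar x$, $\xi\in(0,+\infty]$ and a concave $\phi:[0,\xi)\to\mathbb{R}_+$, continuous at $0$, with $\phi(0)=0$, $\phi\in C^1(0,\xi)$, $\phi'>0$ on $(0,\xi)$, such that $\phi'(J(x)-J(\bar x))\,\mathrm{dist}(0,\partial J(x))\ge1$ for all $x\in U$ with $J(\bar x)<J(x)<J(\bar x)+\xi$. *)

theory Defs
  imports "HOL-Analysis.Analysis" "HOL-Library.Disjoint_Sets" "HOL-Library.Infinite_Set"
begin

section \<open>Blocks of coordinates\<close>

text \<open>
  For an index set \<open>s\<close> the space of subvectors indexed by \<open>s\<close> is realised isometrically as the
  coordinate subspace of vectors vanishing outside \<open>s\<close>. This is needed because the dimension of
  the space on which the reduced function lives depends on the generated sequence.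
\<close>

definition coord_space :: "'n set \<Rightarrow> (real ^ 'n::finite) set" where
  "coord_space s = {v. \<forall>i. i \<notin> s \<longrightarrow> v $ i = 0}"

definition block_part :: "'n set \<Rightarrow> real ^ 'n \<Rightarrow> real ^ 'n::finite" where
  "block_part s v = (\<chi> i. if i \<in> s then v $ i else 0)"

definition replace_block :: "real ^ 'n \<Rightarrow> 'n set \<Rightarrow> real ^ 'n \<Rightarrow> real ^ 'n::finite" where
  "replace_block x s y = (\<chi> i. if i \<in> s then y $ i else x $ i)"

definition supp_idx :: "real ^ 'n \<Rightarrow> 'n::finite set" where
  "supp_idx x = {i. x $ i \<noteq> 0}"


section \<open>Objective, reduced objective, and the algorithm's subproblem\<close>

definition smoothed_obj ::
  "(real ^ 'n \<Rightarrow> real) \<Rightarrow> real \<Rightarrow> real \<Rightarrow> real ^ 'n \<Rightarrow> real ^ 'n::finite \<Rightarrow> real" where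
  "smoothed_obj f lam p x eps = f x + lam * (\<Sum>j\<in>UNIV. (\<bar>x $ j\<bar> + (eps $ j)\<^sup>2) powr p)"

definition reduced_obj ::
  "(real ^ 'n \<Rightarrow> real) \<Rightarrow> real \<Rightarrow> real \<Rightarrow> 'n set \<Rightarrow> (real ^ 'n) \<times> (real ^ 'n::finite) \<Rightarrow> real" where
  "reduced_obj f lam p I = (\<lambda>(x, eps).
     f (block_part I x) + lam * (\<Sum>j\<in>I. (\<bar>x $ j\<bar> + (eps $ j)\<^sup>2) powr p))"

text \<open>
  The set that equals the support of \<open>x k\<close> for all sufficiently large \<open>k\<close>. It is unique whenever
  it exists; its existence for the algorithm's iterates is a property of the algorithm and is not
  built in here.
\<close>

definition eventual_support :: "(nat \<Rightarrow> real ^ 'n) \<Rightarrow> 'n::finite set" where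
  "eventual_support x = (THE I. \<forall>\<^sub>F k in sequentially. supp_idx (x k) = I)"

definition lp_weight :: "real \<Rightarrow> real ^ 'n \<Rightarrow> real ^ 'n \<Rightarrow> 'n::finite \<Rightarrow> real" where
  "lp_weight p x eps j = p * (\<bar>x $ j\<bar> + (eps $ j)\<^sup>2) powr (p - 1)"

text \<open>
  Iterations are numbered from 1, and \<open>b k\<close> is the block updated at iteration \<open>k\<close>. Only the
  coordinates in \<open>b k\<close> of \<open>prev_point b x k\<close> are meaningful: they are the values of that block
  just before its most recent update prior to iteration \<open>k\<close>.
\<close>

definition prev_point :: "(nat \<Rightarrow> 'n set) \<Rightarrow> (nat \<Rightarrow> real ^ 'n) \<Rightarrow> nat \<Rightarrow> real ^ 'n::finite" where
  "prev_point b x k =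
     (let J = {j. 1 \<le> j \<and> j < k \<and> b j = b k} in if J = {} then x 0 else x (Max J - 1))"

definition extrapolated ::
  "(nat \<Rightarrow> 'n set) \<Rightarrow> (nat \<Rightarrow> real) \<Rightarrow> (nat \<Rightarrow> real ^ 'n) \<Rightarrow> nat \<Rightarrow> real ^ 'n::finite" where
  "extrapolated b \<beta> x k =
     block_part (b k) (x (k - 1) + \<beta> k *\<^sub>R (x (k - 1) - prev_point b x k))"

definition block_model ::
  "(real ^ 'n \<Rightarrow> real ^ 'n) \<Rightarrow> real \<Rightarrow> real \<Rightarrow> (nat \<Rightarrow> 'n set) \<Rightarrow> (nat \<Rightarrow> real) \<Rightarrow> (nat \<Rightarrow> real) \<Rightarrow>
   (nat \<Rightarrow> real ^ 'n) \<Rightarrow> (nat \<Rightarrow> real ^ 'n) \<Rightarrow> nat \<Rightarrow> real ^ 'n::finite \<Rightarrow> real" where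
  "block_model gradf lam p b \<alpha> \<beta> x eps k y =
     (let xh = extrapolated b \<beta> x k in
        block_part (b k) (gradf (replace_block (x (k - 1)) (b k) xh)) \<bullet> y
        + 1 / (2 * \<alpha> k) * (norm (y - xh))\<^sup>2
        + lam * (\<Sum>j\<in>b k. lp_weight p (x (k - 1)) (eps (k - 1)) j * \<bar>y $ j\<bar>))"

text \<open>The iteration at which block \<open>s\<close> gets its \<open>j\<close>th update, for \<open>j \<ge> 1\<close>.\<close>

definition update_iter :: "(nat \<Rightarrow> 'n set) \<Rightarrow> 'n set \<Rightarrow> nat \<Rightarrow> nat" where
  "update_iter b s j = enumerate {k. 1 \<le> k \<and> b k = s} (j - 1)"

definition seq_limit_point :: "(nat \<Rightarrow> 'a::topological_space) \<Rightarrow> 'a \<Rightarrow> bool" where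
  "seq_limit_point x a \<longleftrightarrow> (\<exists>r::nat \<Rightarrow> nat. strict_mono r \<and> (x \<circ> r) \<longlonglongrightarrow> a)"


section \<open>Limiting subdifferential and the Kurdyka-Lojasiewicz property\<close>

text \<open>
  All notions are for an extended-real-valued function on a linear subspace \<open>V\<close> of a Euclidean
  space, with \<open>V\<close> carrying the induced inner product; only the values of \<open>J\<close> on \<open>V\<close> matter.
\<close>

definition frechet_subdiff ::
  "'a::euclidean_space set \<Rightarrow> ('a \<Rightarrow> ereal) \<Rightarrow> 'a \<Rightarrow> 'a set" where
  "frechet_subdiff V J x =
     {v \<in> V. x \<in> V \<and> \<bar>J x\<bar> \<noteq> \<infinity> \<and>
        0 \<le> Liminf (at x within V) (\<lambda>y. (J y - J x - ereal (v \<bullet> (y - x))) / ereal (norm (y - x)))}"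

definition limiting_subdiff ::
  "'a::euclidean_space set \<Rightarrow> ('a \<Rightarrow> ereal) \<Rightarrow> 'a \<Rightarrow> 'a set" where
  "limiting_subdiff V J x =
     {v \<in> V. x \<in> V \<and> \<bar>J x\<bar> \<noteq> \<infinity> \<and>
        (\<exists>X W. (\<forall>k::nat. W k \<in> frechet_subdiff V J (X k)) \<and>
           X \<longlonglongrightarrow> x \<and> (\<lambda>k. J (X k)) \<longlonglongrightarrow> J x \<and> W \<longlonglongrightarrow> v)}"

definition proper_closed_on :: "'a::euclidean_space set \<Rightarrow> ('a \<Rightarrow> ereal) \<Rightarrow> bool" where
  "proper_closed_on V J \<longleftrightarrow>
     (\<forall>x\<in>V. J x \<noteq> -\<infinity>) \<and> (\<exists>x\<in>V. J x \<noteq> \<infinity>) \<and> (\<forall>x\<in>V. J x \<le> Liminf (at x within V) J)"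

text \<open>
  The distance from 0 to a set is taken as an extended real, so that it is \<open>\<infinity>\<close> for the empty set
  (the library's \<open>infdist\<close> would give 0).
\<close>

definition dist_zero :: "'a::euclidean_space set \<Rightarrow> ereal" where
  "dist_zero A = (INF v\<in>A. ereal (norm v))"

definition KL_property :: "'a::euclidean_space set \<Rightarrow> ('a \<Rightarrow> ereal) \<Rightarrow> 'a \<Rightarrow> bool" where
  "KL_property V J xb \<longleftrightarrow>
     proper_closed_on V J \<and> limiting_subdiff V J xb \<noteq> {} \<and>
     (\<exists>(U :: 'a set) (\<xi> :: ereal) (\<phi> :: real \<Rightarrow> real) (\<phi>' :: real \<Rightarrow> real).
        open U \<and> xb \<in> U \<and> 0 < \<xi> \<and>
        concave_on {t. 0 \<le> t \<and> ereal t < \<xi>} \<phi> \<and>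
        (\<forall>t. 0 \<le> t \<and> ereal t < \<xi> \<longrightarrow> 0 \<le> \<phi> t) \<and>
        continuous (at 0 within {t. 0 \<le> t \<and> ereal t < \<xi>}) \<phi> \<and>
        \<phi> 0 = 0 \<and>
        (\<forall>t. 0 < t \<and> ereal t < \<xi> \<longrightarrow> (\<phi> has_real_derivative \<phi>' t) (at t)) \<and>
        continuous_on {t. 0 < t \<and> ereal t < \<xi>} \<phi>' \<and>
        (\<forall>t. 0 < t \<and> ereal t < \<xi> \<longrightarrow> 0 < \<phi>' t) \<and>
        (\<forall>x \<in> U \<inter> V. J xb < J x \<and> J x < J xb + \<xi> \<longrightarrow>
           1 \<le> ereal (\<phi>' (real_of_ereal (J x - J xb))) * dist_zero (limiting_subdiff V J x)))"

end

theory Submission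
  imports Defs
begin

text \<open>
  The proof follows the usual route from the Kurdyka-Lojasiewicz inequality to convergence of the
  whole sequence: decrease of the objective, a gradient that is small relative to the increments,
  and a concave function that turns objective gaps into path lengths. Extrapolation, block updates
  and the moving weights each need some care.

  \<^emph>\<open>Decrease.\<close> The block model is strongly convex and the penalty lies below its tangents, so an
  update gains a multiple of its squared increment and loses at most a fraction of the previous
  squared increment of the same block, due to extrapolation (\<open>sufficient_decrease\<close>). Over windows of
  \<open>T\<close> consecutive iterations, in which every block is updated, the losses are paid for by the gains
  of this window and a quarter of those of the window before (\<open>window_decrease\<close>). Hence the
  energies of the windows tend to zero (\<open>window_energy_tendsto_0\<close>).

  \<^emph>\<open>Support.\<close> By optimality, a coordinate that is nonzero after an update had a bounded weight
  before it. A coordinate that is nonzero infinitely often has a smoothing parameter tending to zero,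
  so its weight at zero is unbounded and it cannot return to zero and leave it again. Therefore the
  support settles on a set \<open>I\<close> (\<open>eventually_supp_idx\<close>), and on \<open>I\<close> the smoothing parameters decay
  geometrically while the arguments of the weights stay away from zero (\<open>final_support_behaviour\<close>).
  Off \<open>I\<close> nothing changes any more, and the objective differs from the reduced function by a constant.

  \<^emph>\<open>Gradient.\<close> Along the iterates the reduced function is differentiable. Comparing its gradient with
  the optimality conditions of the most recent updates shows that its norm at the end of a window is
  bounded by the lengths of the last two windows and a geometric term (\<open>reduced_gradient_bound\<close>).

  \<^emph>\<open>Conclusion.\<close> Near the limit point, the Kurdyka-Lojasiewicz inequality turns these two estimates
  into a contracting recursion for the window lengths up to telescoping terms. So the distance
  travelled in a window is at most the decrease of a potential tending to zero. A sequence with this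
  property near one of its limit points cannot escape from it (\<open>trapped_near_limit_point\<close>).
\<close>


section \<open>Calculus and convexity\<close>

lemma norm_le_card_mult_bound:
  fixes v :: "real ^ 'n::finite"
  assumes "\<And>i. \<bar>v $ i\<bar> \<le> B"
  shows "norm v \<le> real CARD('n) * B"
proof -
  have "norm v \<le> (\<Sum>i\<in>UNIV. \<bar>v $ i\<bar>)" by (rule norm_le_l1_cart)
  also have "\<dots> \<le> (\<Sum>i\<in>(UNIV::'n set). B)" by (intro sum_mono assms)
  finally show ?thesis by simp
qed

text \<open>Concavity of the power, obtained from Young's inequality with weights \<open>p\<close> and \<open>1 - p\<close>.\<close>

lemma powr_le_tangent:
  fixes s t p :: real
  assumes "0 < s" "0 < t" "0 < p" "p < 1"
  shows "t powr p \<le> s powr p + p * s powr (p - 1) * (t - s)"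
proof -
  have "t powr p * s powr (1 - p) \<le> p * t + (1 - p) * s"
    using Youngs_inequality_0[of p "1 - p" t s] assms by simp
  then have "(t powr p * s powr (1 - p)) * s powr (p - 1) \<le> (p * t + (1 - p) * s) * s powr (p - 1)"
    by (rule mult_right_mono) simp
  moreover have "s powr (1 - p) * s powr (p - 1) = 1"
    using assms by (simp add: powr_add[symmetric])
  moreover have "s * s powr (p - 1) = s powr p"
    using assms by (simp add: powr_mult_base)
  ultimately show ?thesis by (simp add: algebra_simps)
qed

lemma powr_lipschitz_away_from_0:
  fixes c q s t :: real
  assumes "0 < c" "c \<le> s" "c \<le> t" "q < 0"
  shows "\<bar>s powr q - t powr q\<bar> \<le> \<bar>q\<bar> * c powr (q - 1) * \<bar>s - t\<bar>"
proof -
  have "norm (s powr q - t powr q) \<le> (\<bar>q\<bar> * c powr (q - 1)) * norm (s - t)"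
  proof (rule field_differentiable_bound[where S = "{c..}" and f' = "\<lambda>z. q * z powr (q - 1)"])
    fix z assume z: "z \<in> {c..}"
    then show "((\<lambda>z. z powr q) has_field_derivative q * z powr (q - 1)) (at z within {c..})"
      using assms by (auto intro!: derivative_eq_intros)
    have "z powr (q - 1) \<le> c powr (q - 1)"
      using z assms by (intro powr_mono2') auto
    then show "norm (q * z powr (q - 1)) \<le> \<bar>q\<bar> * c powr (q - 1)"
      by (simp add: abs_mult mult_left_mono)
  qed (use assms in auto)
  then show ?thesis by simp
qed

lemma concave_on_le_tangent:
  fixes \<phi> :: "real \<Rightarrow> real"
  assumes "concave_on A \<phi>" "connected A" "c \<in> interior A" "t \<in> A"
    and "(\<phi> has_real_derivative d) (at c)"
  shows "\<phi> t \<le> \<phi> c + d * (t - c)"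
proof -
  have "((\<lambda>t. - \<phi> t) has_field_derivative - d) (at c within A)"
    using assms(5) by (auto intro!: derivative_eq_intros intro: DERIV_subset)
  from convex_on_imp_above_tangent[OF _ assms(2,3,4) this] assms(1)
  show ?thesis by (simp add: concave_on_def)
qed

text \<open>
  For positive \<open>c\<close> the function \<open>m\<close> is strongly convex with modulus \<open>2 * c\<close>, so it grows quadratically
  away from its minimiser: compare the minimiser with points of the segment towards \<open>u\<close> that are close
  to it, divide by the distance parameter and let it vanish.
\<close>

lemma quadratic_growth_at_minimizer:
  fixes q :: "'a::real_inner \<Rightarrow> real" and g h :: 'a and c :: real
  defines "m \<equiv> \<lambda>y. g \<bullet> y + c * (norm (y - h))\<^sup>2 + q y"
  assumes q: "convex_on C q" and y: "y \<in> C" and u: "u \<in> C"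
    and min: "\<And>z. z \<in> C \<Longrightarrow> m y \<le> m z"
  shows "m y + c * (norm (u - y))\<^sup>2 \<le> m u"
proof -
  have C: "convex C" using q by (simp add: convex_on_def)
  have *: "c * (1 - t) * (norm (u - y))\<^sup>2 \<le> m u - m y" if t: "0 < t" "t < 1" for t
  proof -
    let ?z = "(1 - t) *\<^sub>R y + t *\<^sub>R u"
    have z: "?z \<in> C" using convexD_alt[OF C y u, of t] t by simp
    have q': "q ?z \<le> (1 - t) * q y + t * q u"
      using q y u t unfolding convex_on_def by auto
    have z': "?z - h = (1 - t) *\<^sub>R (y - h) + t *\<^sub>R (u - h)" by (simp add: algebra_simps)
    have uy: "u - y = (u - h) - (y - h)" by simp
    have n: "(norm (?z - h))\<^sup>2
        = (1 - t) * (norm (y - h))\<^sup>2 + t * (norm (u - h))\<^sup>2 - t * (1 - t) * (norm (u - y))\<^sup>2"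
      unfolding z' uy power2_norm_eq_inner
      by (simp add: algebra_simps inner_commute power2_eq_square)
    have "m y \<le> m ?z" by (rule min[OF z])
    also have "m ?z \<le> (1 - t) * m y + t * m u - c * (t * (1 - t) * (norm (u - y))\<^sup>2)"
      using q' unfolding m_def n by (simp add: inner_add_right algebra_simps)
    finally have "t * (c * (1 - t) * (norm (u - y))\<^sup>2) \<le> t * (m u - m y)"
      by (simp add: algebra_simps)
    then show ?thesis using t by simp
  qed
  have "((\<lambda>t. c * (1 - t) * (norm (u - y))\<^sup>2) \<longlongrightarrow> c * (1 - 0) * (norm (u - y))\<^sup>2) (at_right 0)"
    by (intro tendsto_intros)
  moreover have "eventually (\<lambda>t. c * (1 - t) * (norm (u - y))\<^sup>2 \<le> m u - m y) (at_right 0)"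
    using eventually_at_right_real[OF zero_less_one] by eventually_elim (auto intro: *)
  ultimately have "c * (1 - 0) * (norm (u - y))\<^sup>2 \<le> m u - m y"
    by (intro tendsto_upperbound) auto
  then show ?thesis by simp
qed

text \<open>
  The form in which a coordinatewise optimality condition is read off a quadratic model: along a
  coordinate that does not change its sign the weighted absolute value is affine.
\<close>

lemma zero_slope_if_local_min_quadratic:
  fixes A c d :: real
  assumes "0 < d" "\<And>t. \<bar>t\<bar> < d \<Longrightarrow> 0 \<le> t * A + c * t\<^sup>2"
  shows "A = 0"
proof (rule DERIV_local_min[of "\<lambda>t. t * A + c * t\<^sup>2" A 0 d])
  show "((\<lambda>t. t * A + c * t\<^sup>2) has_real_derivative A) (at 0)"
    by (auto intro!: derivative_eq_intros)
qed (use assms in auto)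


section \<open>Blocks of coordinates\<close>

lemma block_part_nth [simp]: "block_part s v $ i = (if i \<in> s then v $ i else 0)"
  by (simp add: block_part_def)

lemma replace_block_nth [simp]: "replace_block v s y $ i = (if i \<in> s then y $ i else v $ i)"
  by (simp add: replace_block_def)

lemma block_part_in_coord_space [simp]: "block_part s v \<in> coord_space s"
  by (simp add: coord_space_def)

lemma coord_space_add: "u \<in> coord_space s \<Longrightarrow> v \<in> coord_space s \<Longrightarrow> u + v \<in> coord_space s"
  and coord_space_scaleR: "v \<in> coord_space s \<Longrightarrow> r *\<^sub>R v \<in> coord_space s"
  by (simp_all add: coord_space_def)

lemma convex_coord_space: "convex (coord_space s)"
  by (simp add: convex_def coord_space_def)

lemma block_part_eq_if_coord_space: "v \<in> coord_space s \<Longrightarrow> block_part s v = v"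
  by (auto simp: coord_space_def vec_eq_iff)

lemma inner_block_part_left: "block_part s g \<bullet> v = g \<bullet> block_part s v"
  unfolding inner_vec_def by (intro sum.cong) auto

text \<open>
  The usual descent estimate along a segment; only displacements inside the block \<open>s\<close> are needed,
  so Lipschitz continuity of the partial gradient in that block is enough.
\<close>

lemma block_descent:
  fixes f :: "real ^ 'n::finite \<Rightarrow> real"
  assumes grad: "\<And>z. GDERIV f z :> gradf z"
    and lip: "K-lipschitz_on (coord_space s) (\<lambda>y. block_part s (gradf (replace_block u s y)))"
    and d: "d \<in> coord_space s"
  shows "f (u + d) \<le> f u + gradf u \<bullet> d + K / 2 * (norm d)\<^sup>2"
proof -
  let ?h = "\<lambda>t. f (u + t *\<^sub>R d) - t * (gradf u \<bullet> d) - K / 2 * (norm d)\<^sup>2 * t\<^sup>2"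
  have "?h 1 \<le> ?h 0"
  proof (rule DERIV_nonpos_imp_nonincreasing[of 0 1 ?h])
    fix t :: real assume t: "0 \<le> t" "t \<le> 1"
    let ?D = "d \<bullet> gradf (u + t *\<^sub>R d) - gradf u \<bullet> d - K * (norm d)\<^sup>2 * t"
    have "(f has_derivative (\<lambda>h. h \<bullet> gradf (u + t *\<^sub>R d))) (at (u + t *\<^sub>R d))"
      using grad[of "u + t *\<^sub>R d"] by (simp add: gderiv_def)
    then have "((\<lambda>t. f (u + t *\<^sub>R d)) has_derivative
        (\<lambda>h. (h *\<^sub>R d) \<bullet> gradf (u + t *\<^sub>R d))) (at t)"
      by (rule has_derivative_compose[where f = "\<lambda>t. u + t *\<^sub>R d", rotated])
        (auto intro!: derivative_eq_intros)
    then have "((\<lambda>t. f (u + t *\<^sub>R d)) has_real_derivative (d \<bullet> gradf (u + t *\<^sub>R d))) (at t)"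
      by (rule has_derivative_imp_has_field_derivative) simp
    then have der: "(?h has_real_derivative ?D) (at t)"
      by (auto intro!: derivative_eq_intros)
    let ?g = "\<lambda>y. block_part s (gradf (replace_block u s y))"
    have r: "replace_block u s (block_part s u + t *\<^sub>R d) = u + t *\<^sub>R d"
      using d by (auto simp: vec_eq_iff coord_space_def)
    have r0: "replace_block u s (block_part s u) = u" by (auto simp: vec_eq_iff)
    have "gradf (u + t *\<^sub>R d) \<bullet> d - gradf u \<bullet> d
        = (gradf (u + t *\<^sub>R d) - gradf u) \<bullet> block_part s d"
      by (simp add: inner_diff_left block_part_eq_if_coord_space[OF d])
    also have "\<dots> = (?g (block_part s u + t *\<^sub>R d) - ?g (block_part s u)) \<bullet> d"
      unfolding r r0
      by (simp add: inner_block_part_left inner_diff_left)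
    also have "\<dots> \<le> norm (?g (block_part s u + t *\<^sub>R d) - ?g (block_part s u)) * norm d"
      by (rule norm_cauchy_schwarz)
    also have "\<dots> \<le> (K * norm (t *\<^sub>R d)) * norm d"
      using lipschitz_onD[OF lip, of "block_part s u + t *\<^sub>R d" "block_part s u"] d
      by (intro mult_right_mono) (simp_all add: dist_norm coord_space_add coord_space_scaleR)
    also have "\<dots> = K * (norm d)\<^sup>2 * t"
      using t by (simp add: power2_eq_square)
    finally have "?D \<le> 0" by (simp add: inner_commute)
    with der show "\<exists>D. (?h has_real_derivative D) (at t) \<and> D \<le> 0" by blast
  qed simp
  then show ?thesis by simp
qed


section \<open>Subgradients and the trapping principle\<close>

text \<open>
  A Kurdyka-Lojasiewicz inequality bounds the distance of 0 to the limiting subdifferential from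
  below. To exploit it, any single subgradient of small norm is enough, and where the function is
  differentiable its gradient is one.
\<close>

lemma gradient_in_limiting_subdiff:
  fixes R :: "'a::euclidean_space \<Rightarrow> real"
  assumes der: "(R has_derivative (\<lambda>h. v \<bullet> h)) (at z)" and "v \<in> V" "z \<in> V"
  shows "v \<in> limiting_subdiff V (\<lambda>z. ereal (R z)) z"
proof -
  have "0 \<le> Liminf (at z within V)
      (\<lambda>y. (ereal (R y) - ereal (R z) - ereal (v \<bullet> (y - z))) / ereal (norm (y - z)))"
    unfolding le_Liminf_iff
  proof (intro allI impI)
    fix c :: ereal assume "c < 0"
    then obtain c' where c': "c < ereal c'" "c' < 0"
      using ereal_dense2[of c 0] by (auto simp: zero_ereal_def)
    have "((\<lambda>y. (R y - (R z + v \<bullet> (y - z))) / norm (y - z)) \<longlongrightarrow> 0) (at z within V)"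
      using has_derivative_at_withinI[OF der, of V]
      unfolding has_derivative_within by (simp add: divide_inverse_commute)
    from order_tendstoD(1)[OF this c'(2)]
    moreover have "eventually (\<lambda>y. y \<noteq> z) (at z within V)"
      by (simp add: eventually_at_filter)
    ultimately show "eventually
        (\<lambda>y. c < (ereal (R y) - ereal (R z) - ereal (v \<bullet> (y - z))) / ereal (norm (y - z)))
        (at z within V)"
    proof eventually_elim
      case (elim y)
      then have "c' < (R y - R z - v \<bullet> (y - z)) / norm (y - z)"
        by (simp add: field_simps)
      then show ?case using c'(1) elim(2) by (simp add: less_trans[of c])
    qed
  qed
  then have "v \<in> frechet_subdiff V (\<lambda>z. ereal (R z)) z"
    using assms by (simp add: frechet_subdiff_def)
  then show ?thesis
    unfolding limiting_subdiff_def using assms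
    by (intro CollectI conjI exI[of _ "\<lambda>_. z"] exI[of _ "\<lambda>_. v"]) auto
qed

text \<open>
  Inside the ball the quantity \<open>dist (y m) a + Q m\<close> cannot increase, and it is as small as desired
  at some index because \<open>Q\<close> tends to zero and \<open>a\<close> is a limit point. From that index on it stays
  that small, which both keeps the sequence inside the ball and makes it converge.
\<close>

lemma trapped_near_limit_point:
  fixes y :: "nat \<Rightarrow> 'a::metric_space" and Q :: "nat \<Rightarrow> real"
  assumes "0 < \<rho>"
    and step: "\<And>m. M \<le> m \<Longrightarrow> dist (y m) a < \<rho> \<Longrightarrow> dist (y (Suc m)) (y m) \<le> Q m - Q (Suc m)"
    and Q: "\<And>m. M \<le> m \<Longrightarrow> 0 \<le> Q m" "Q \<longlonglongrightarrow> 0"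
    and r: "filterlim r at_top sequentially" "(\<lambda>k. y (r k)) \<longlonglongrightarrow> a"
  shows "y \<longlonglongrightarrow> a"
proof (rule metric_LIMSEQ_I)
  fix e :: real assume "0 < e"
  define e' where "e' = min e \<rho>"
  have e': "0 < e'" using \<open>0 < e\<close> \<open>0 < \<rho>\<close> by (simp add: e'_def)
  have "(\<lambda>k. dist (y (r k)) a + Q (r k)) \<longlonglongrightarrow> dist a a + 0"
    by (intro tendsto_intros r(2) filterlim_compose[OF Q(2) r(1)])
  then have "eventually (\<lambda>k. dist (y (r k)) a + Q (r k) < e') sequentially"
    using e' by (intro order_tendstoD(2)) auto
  moreover have "eventually (\<lambda>k. M \<le> r k) sequentially"
    using r(1) by (simp add: filterlim_at_top)
  ultimately have "eventually (\<lambda>k. M \<le> r k \<and> dist (y (r k)) a + Q (r k) < e') sequentially"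
    by eventually_elim simp
  then obtain k where "M \<le> r k \<and> dist (y (r k)) a + Q (r k) < e'"
    by (auto dest: eventually_happens)
  then obtain m0 where m0: "M \<le> m0" "dist (y m0) a + Q m0 < e'" by blast
  have inv: "dist (y m) a + Q m < e'" if "m0 \<le> m" for m
    using that
  proof (induction m rule: dec_induct)
    case (step m)
    have "dist (y m) a < \<rho>" using step.IH Q(1)[of m] step.hyps m0 by (simp add: e'_def)
    then have "dist (y (Suc m)) (y m) \<le> Q m - Q (Suc m)"
      using assms(2)[of m] step.hyps m0 by simp
    with step.IH show ?case using dist_triangle[of "y (Suc m)" a "y m"] by simp
  qed (fact m0(2))
  have "dist (y m) a < e" if "m0 \<le> m" for m
    using inv[OF that] Q(1)[of m] m0 that by (simp add: e'_def)
  then show "\<exists>no. \<forall>n\<ge>no. dist (y n) a < e" by blast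
qed


section \<open>Bookkeeping of block updates\<close>

text \<open>
  The value 0 stands for "no earlier update". Index 0 carries the zero increment \<open>x 0 - x (0 - 1)\<close>,
  so that blocks updated for the first time need no separate treatment.
\<close>

definition last_update :: "(nat \<Rightarrow> 'a) \<Rightarrow> nat \<Rightarrow> nat" where
  "last_update b k = Max (insert 0 {j. 1 \<le> j \<and> j < k \<and> b j = b k})"

lemma last_update_less: "1 \<le> k \<Longrightarrow> last_update b k < k"
  by (auto simp: last_update_def)

lemma same_block_last_update:
  assumes "1 \<le> last_update b k"
  shows "b (last_update b k) = b k"
proof -
  have "last_update b k \<in> insert 0 {j. 1 \<le> j \<and> j < k \<and> b j = b k}"
    unfolding last_update_def by (rule Max_in) auto
  then show ?thesis using assms by auto
qed

lemma le_last_update: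
  assumes "1 \<le> j" "j < k" "b j = b k"
  shows "j \<le> last_update b k"
  unfolding last_update_def by (rule Max_ge) (use assms in auto)

text \<open>
  Injectivity is what allows sums of increments at \<open>last_update b k\<close> to be bounded by sums of
  increments without multiplicities.
\<close>

lemma inj_on_last_update: "inj_on (last_update b) {k. 1 \<le> last_update b k}"
proof (rule linorder_inj_onI')
  fix j k assume "j \<in> {k. 1 \<le> last_update b k}" "k \<in> {k. 1 \<le> last_update b k}" "j < k"
  then have jk: "1 \<le> last_update b j" "1 \<le> last_update b k" "j < k" by auto
  show "last_update b j \<noteq> last_update b k"
  proof
    assume eq: "last_update b j = last_update b k"
    have "j \<noteq> 0" using jk(1) by (intro notI) (simp add: last_update_def)
    moreover have "b j = b k"
      using same_block_last_update[OF jk(1)] same_block_last_update[OF jk(2)] eq by simp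
    ultimately have "j \<le> last_update b k" using jk(3) by (intro le_last_update) auto
    then show False using last_update_less[of j b] \<open>j \<noteq> 0\<close> eq by simp
  qed
qed

lemma prev_point_eq: "prev_point b x k = x (last_update b k - 1)"
proof -
  define J where "J = {j. 1 \<le> j \<and> j < k \<and> b j = b k}"
  have "finite J" by (simp add: J_def)
  then have "Max (insert 0 J) = Max J" if "J \<noteq> {}" using that by simp
  then show ?thesis
    unfolding prev_point_def last_update_def J_def[symmetric] Let_def by auto
qed

lemma update_iter_successive:
  assumes inf: "infinite {k. 1 \<le> k \<and> b k = s}" and k: "1 \<le> k" "b k = s" "1 \<le> last_update b k"
  obtains j where "1 \<le> j" "update_iter b s j = last_update b k" "update_iter b s (Suc j) = k"
proof -
  let ?A = "{k. 1 \<le> k \<and> b k = s}"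
  obtain n where n: "enumerate ?A n = k" using enumerate_Ex[OF inf, of k] k by auto
  have pA: "last_update b k \<in> ?A" using k same_block_last_update[of b k] by auto
  then obtain n' where n': "enumerate ?A n' = last_update b k" using enumerate_Ex[OF inf] by blast
  have "n' < n" using last_update_less[OF k(1), of b] n n' enumerate_mono_iff[OF inf] by metis
  then obtain j where j: "n = Suc j" by (cases n) auto
  have "enumerate ?A j < k" using enumerate_step[OF inf, of j] n j by simp
  then have "enumerate ?A j \<le> last_update b k"
    using enumerate_in_set[OF inf, of j] k by (intro le_last_update) auto
  moreover have "last_update b k \<le> enumerate ?A j"
    using \<open>n' < n\<close> j enumerate_mono_le_iff[OF inf, of n' j] n' by simp
  ultimately have "update_iter b s (Suc j) = last_update b k" by (simp add: update_iter_def)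
  moreover have "update_iter b s (Suc (Suc j)) = k" using n j by (simp add: update_iter_def)
  ultimately show thesis using that[of "Suc j"] by simp
qed


section \<open>The algorithm: sufficient decrease\<close>

text \<open>
  The extrapolation bound enters only through \<open>beta_le\<close>, in which the constant \<open>\<delta>\<close> below 1 is
  absorbed and the enumeration of the updates of a block is replaced by \<open>last_update\<close>.
\<close>

locale extrapolated_block_descent =
  fixes f :: "real ^ 'n::finite \<Rightarrow> real"
    and gradf :: "real ^ 'n \<Rightarrow> real ^ 'n"
    and S :: "'n set set"
    and p lam l L \<mu> :: real
    and T :: nat
    and b :: "nat \<Rightarrow> 'n set"
    and x eps :: "nat \<Rightarrow> real ^ 'n"
    and \<alpha> \<beta> Lip :: "nat \<Rightarrow> real"
  assumes blocks: "partition_on UNIV S"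
    and p: "0 < p" "p < 1"
    and lam: "0 < lam"
    and f_grad: "\<And>z. GDERIV f z :> gradf z"
    and gradf_cont: "continuous_on UNIV gradf"
    and l_pos: "0 < l"
    and coercive: "filterlim (\<lambda>z. smoothed_obj f lam p z 0) at_top at_infinity"
    and mu: "0 < \<mu>" "\<mu> < 1"
    and eps0: "\<And>i. 0 < eps 0 $ i"
    and b_block: "\<And>k. 1 \<le> k \<Longrightarrow> b k \<in> S"
    and x_keep: "\<And>k i. 1 \<le> k \<Longrightarrow> i \<notin> b k \<Longrightarrow> x k $ i = x (k - 1) $ i"
    and x_update: "\<And>k. 1 \<le> k \<Longrightarrow>
          is_arg_min (block_model gradf lam p b \<alpha> \<beta> x eps k) (\<lambda>y. y \<in> coord_space (b k))
            (block_part (b k) (x k))"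
    and beta_range: "\<And>k. 1 \<le> k \<Longrightarrow> 0 \<le> \<beta> k \<and> \<beta> k \<le> 1"
    and eps_keep: "\<And>k i. x (k + 1) $ i = 0 \<Longrightarrow> eps (k + 1) $ i = eps k $ i"
    and eps_shrink: "\<And>k i. x (k + 1) $ i \<noteq> 0 \<Longrightarrow>
          0 < eps (k + 1) $ i \<and> eps (k + 1) $ i \<le> sqrt \<mu> * eps k $ i"
    and Lip_range: "\<And>k. 1 \<le> k \<Longrightarrow> Lip k \<in> {l..L}"
    and Lip_lipschitz: "\<And>k. 1 \<le> k \<Longrightarrow>
          (Lip k)-lipschitz_on (coord_space (b k))
             (\<lambda>y. block_part (b k) (gradf (replace_block (x (k - 1)) (b k) y)))"
    and alpha: "\<And>k. 1 \<le> k \<Longrightarrow> \<alpha> k = 1 / (2 * Lip k)"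
    and beta_le: "\<And>k. 1 \<le> last_update b k \<Longrightarrow> 1 \<le> k \<Longrightarrow>
          \<beta> k \<le> 1 / 6 * sqrt (Lip (last_update b k) / Lip k)"
    and cyclic: "\<And>s k. s \<in> S \<Longrightarrow> 1 \<le> k \<Longrightarrow> \<exists>j\<in>{k..<k + T}. b j = s"
    and monotone_obj: "\<And>k. 1 \<le> k \<Longrightarrow>
          smoothed_obj f lam p (x k) (eps k) \<le> smoothed_obj f lam p (x (k - 1)) (eps (k - 1))"
begin

definition step :: "nat \<Rightarrow> real ^ 'n" where "step k = x k - x (k - 1)"

text \<open>The point at which the partial gradient is evaluated in iteration \<open>k\<close>.\<close>

definition extrap_point :: "nat \<Rightarrow> real ^ 'n" where
  "extrap_point k = x (k - 1) + \<beta> k *\<^sub>R step (last_update b k)"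

definition obj :: "nat \<Rightarrow> real" where "obj k = smoothed_obj f lam p (x k) (eps k)"

definition energy :: "nat \<Rightarrow> real" where "energy k = Lip k * (norm (step k))\<^sup>2"

lemma Lip_pos: "1 \<le> k \<Longrightarrow> 0 < Lip k"
  using Lip_range[of k] l_pos by auto

lemma step_0 [simp]: "step 0 = 0"
  by (simp add: step_def)

lemma energy_nonneg: "0 \<le> energy k"
  using Lip_pos[of k] by (cases "k = 0") (auto simp: energy_def)

lemma eps_pos: "0 < eps k $ i"
proof (induction k)
  case (Suc k)
  then show ?case using eps_keep[of k i] eps_shrink[of k i] by fastforce
qed (rule eps0)

lemma eps_Suc_le: "eps (Suc k) $ i \<le> eps k $ i"
proof (cases "x (Suc k) $ i = 0")
  case False
  have "sqrt \<mu> * eps k $ i \<le> 1 * eps k $ i"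
    using mu eps_pos[of k i] by (intro mult_right_mono) auto
  then show ?thesis using eps_shrink[of k i] False by simp
qed (use eps_keep[of k i] in simp)

lemma eps_antimono: "m \<le> n \<Longrightarrow> eps n $ i \<le> eps m $ i"
  by (rule lift_Suc_antimono_le[of "\<lambda>k. eps k $ i"]) (auto intro: eps_Suc_le)

lemma coordinate_const:
  assumes "m \<le> n" "\<And>j. m < j \<Longrightarrow> j \<le> n \<Longrightarrow> i \<notin> b j"
  shows "x n $ i = x m $ i"
  using assms
proof (induction n rule: dec_induct)
  case (step n)
  then show ?case using x_keep[of "Suc n" i] by simp
qed simp

lemma step_in_block: "step k \<in> coord_space (b k)"
  using x_keep[of k] by (cases "k = 0") (auto simp: coord_space_def step_def)

lemma blocks_eq_if_inter:
  assumes "1 \<le> j" "1 \<le> k" "i \<in> b j" "i \<in> b k"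
  shows "b j = b k"
  using partition_onD2[OF blocks] b_block[OF assms(1)] b_block[OF assms(2)] assms(3,4)
  by (auto simp: disjoint_def)

lemma step_last_update_in_block: "step (last_update b k) \<in> coord_space (b k)"
proof (cases "last_update b k = 0")
  case False
  then show ?thesis
    using step_in_block[of "last_update b k"] same_block_last_update[of b k] by simp
qed (simp add: coord_space_def)

text \<open>
  Between two successive updates of a block its coordinates do not move, so the extrapolation
  direction is the increment of the last update.
\<close>

lemma extrapolated_eq:
  assumes k: "1 \<le> k"
  shows "extrapolated b \<beta> x k = block_part (b k) (extrap_point k)"
proof -
  have "(x (k - 1) - x (last_update b k - 1)) $ i = step (last_update b k) $ i" if "i \<in> b k" for i
  proof -
    have "x (k - 1) $ i = x (last_update b k) $ i"
    proof (rule coordinate_const)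
      show "last_update b k \<le> k - 1" using last_update_less[OF k, of b] by simp
      show "i \<notin> b j" if j: "last_update b k < j" "j \<le> k - 1" for j
      proof
        assume "i \<in> b j"
        then have "b j = b k" using blocks_eq_if_inter[of j k i] \<open>i \<in> b k\<close> j k by simp
        moreover have "1 \<le> j" "j < k" using j k by auto
        ultimately show False using le_last_update[of j k b] j by simp
      qed
    qed
    then show ?thesis by (simp add: step_def)
  qed
  then show ?thesis
    by (simp add: extrapolated_def prev_point_eq vec_eq_iff extrap_point_def)
qed

lemma replace_block_extrapolated:
  "replace_block (x (k - 1)) (b k) (block_part (b k) (extrap_point k)) = extrap_point k"
  using step_last_update_in_block[of k]
  by (auto simp: vec_eq_iff extrap_point_def coord_space_def)

lemma block_model_eq:
  assumes "1 \<le> k"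
  shows "block_model gradf lam p b \<alpha> \<beta> x eps k y =
     block_part (b k) (gradf (extrap_point k)) \<bullet> y
     + Lip k * (norm (y - block_part (b k) (extrap_point k)))\<^sup>2
     + lam * (\<Sum>j\<in>b k. lp_weight p (x (k - 1)) (eps (k - 1)) j * \<bar>y $ j\<bar>)"
  using assms Lip_pos[OF assms]
  unfolding block_model_def Let_def extrapolated_eq[OF assms] replace_block_extrapolated
  by (simp add: alpha)

lemma lp_weight_nonneg: "0 \<le> lp_weight p u e j"
  using p by (simp add: lp_weight_def)

text \<open>
  Minimality of the new block in the strongly convex model, compared with the old block. The norm
  squares of the model are already expanded in terms of the two increments.
\<close>

lemma model_decrease:
  assumes k: "1 \<le> k"
  defines "w \<equiv> lp_weight p (x (k - 1)) (eps (k - 1))"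
  shows "lam * (\<Sum>j\<in>b k. w j * (\<bar>x k $ j\<bar> - \<bar>x (k - 1) $ j\<bar>)) \<le>
     - (gradf (extrap_point k) \<bullet> step k) - 2 * Lip k * (norm (step k))\<^sup>2
     + 2 * Lip k * \<beta> k * (step k \<bullet> step (last_update b k))"
proof -
  define g where "g = block_part (b k) (gradf (extrap_point k))"
  define h where "h = block_part (b k) (extrap_point k)"
  define q where "q y = lam * (\<Sum>j\<in>b k. w j * \<bar>y $ j\<bar>)" for y :: "real ^ 'n"
  define y where "y = block_part (b k) (x k)"
  define u where "u = block_part (b k) (x (k - 1))"
  let ?d = "step k" and ?d' = "step (last_update b k)"
  have model: "block_model gradf lam p b \<alpha> \<beta> x eps k z = g \<bullet> z + Lip k * (norm (z - h))\<^sup>2 + q z" for z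
    using block_model_eq[OF k] by (simp add: g_def h_def q_def w_def)
  have "convex_on (coord_space (b k)) q"
    unfolding q_def convex_on_def
  proof (intro conjI convex_coord_space ballI allI impI)
    fix y z :: "real ^ 'n" and s t :: real assume "0 \<le> s" "0 \<le> t" "s + t = 1"
    have "(\<Sum>j\<in>b k. w j * \<bar>(s *\<^sub>R y + t *\<^sub>R z) $ j\<bar>)
        \<le> (\<Sum>j\<in>b k. s * (w j * \<bar>y $ j\<bar>) + t * (w j * \<bar>z $ j\<bar>))"
    proof (rule sum_mono)
      fix j
      have "\<bar>(s *\<^sub>R y + t *\<^sub>R z) $ j\<bar> \<le> s * \<bar>y $ j\<bar> + t * \<bar>z $ j\<bar>"
        using abs_triangle_ineq[of "s * y $ j" "t * z $ j"] \<open>0 \<le> s\<close> \<open>0 \<le> t\<close> by (simp add: abs_mult)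
      then have "w j * \<bar>(s *\<^sub>R y + t *\<^sub>R z) $ j\<bar> \<le> w j * (s * \<bar>y $ j\<bar> + t * \<bar>z $ j\<bar>)"
        by (rule mult_left_mono) (simp add: w_def lp_weight_nonneg)
      then show "w j * \<bar>(s *\<^sub>R y + t *\<^sub>R z) $ j\<bar> \<le> s * (w j * \<bar>y $ j\<bar>) + t * (w j * \<bar>z $ j\<bar>)"
        by (simp add: algebra_simps)
    qed
    then have "lam * (\<Sum>j\<in>b k. w j * \<bar>(s *\<^sub>R y + t *\<^sub>R z) $ j\<bar>)
        \<le> lam * (\<Sum>j\<in>b k. s * (w j * \<bar>y $ j\<bar>) + t * (w j * \<bar>z $ j\<bar>))"
      using lam by (intro mult_left_mono) auto
    then show "lam * (\<Sum>j\<in>b k. w j * \<bar>(s *\<^sub>R y + t *\<^sub>R z) $ j\<bar>)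
        \<le> s * (lam * (\<Sum>j\<in>b k. w j * \<bar>y $ j\<bar>)) + t * (lam * (\<Sum>j\<in>b k. w j * \<bar>z $ j\<bar>))"
      by (simp add: sum.distrib sum_distrib_left algebra_simps)
  qed
  from quadratic_growth_at_minimizer[OF this, of y u g "Lip k" h] x_update[OF k]
  have *: "g \<bullet> y + Lip k * (norm (y - h))\<^sup>2 + q y + Lip k * (norm (u - y))\<^sup>2
      \<le> g \<bullet> u + Lip k * (norm (u - h))\<^sup>2 + q u"
    by (simp add: is_arg_min_def model y_def u_def not_less)
  have yu: "y = u + ?d"
    using step_in_block[of k] by (auto simp: y_def u_def step_def vec_eq_iff coord_space_def)
  have hu: "h = u + \<beta> k *\<^sub>R ?d'"
    using step_last_update_in_block[of k]
    by (auto simp: h_def u_def extrap_point_def vec_eq_iff coord_space_def)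
  have "Lip k * (norm (y - h))\<^sup>2 = Lip k * ((norm ?d)\<^sup>2 - 2 * \<beta> k * (?d \<bullet> ?d') + (norm (u - h))\<^sup>2)"
    unfolding yu hu power2_norm_eq_inner by (simp add: algebra_simps inner_commute)
  then have e: "Lip k * (norm (y - h))\<^sup>2
      = Lip k * (norm ?d)\<^sup>2 - 2 * Lip k * \<beta> k * (?d \<bullet> ?d') + Lip k * (norm (u - h))\<^sup>2"
    by (simp add: algebra_simps)
  have gd: "g \<bullet> y - g \<bullet> u = gradf (extrap_point k) \<bullet> ?d"
    unfolding yu g_def
    by (simp add: inner_add_right inner_block_part_left
        block_part_eq_if_coord_space[OF step_in_block])
  have "lam * (\<Sum>j\<in>b k. w j * (\<bar>x k $ j\<bar> - \<bar>x (k - 1) $ j\<bar>)) = q y - q u"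
    by (simp add: q_def y_def u_def right_diff_distrib sum_subtractf cong: sum.cong)
  moreover have "norm (u - y) = norm ?d" by (simp add: yu)
  ultimately show ?thesis using * e gd by simp
qed

text \<open>
  Replacing the concave penalty by its tangent costs nothing from above, and shrinking the
  smoothing parameters only helps.
\<close>

lemma penalty_le:
  assumes k: "1 \<le> k"
  shows "(\<Sum>j\<in>UNIV. (\<bar>x k $ j\<bar> + (eps k $ j)\<^sup>2) powr p) \<le>
     (\<Sum>j\<in>UNIV. (\<bar>x (k - 1) $ j\<bar> + (eps (k - 1) $ j)\<^sup>2) powr p)
     + (\<Sum>j\<in>b k. lp_weight p (x (k - 1)) (eps (k - 1)) j * (\<bar>x k $ j\<bar> - \<bar>x (k - 1) $ j\<bar>))"
proof -
  let ?w = "lp_weight p (x (k - 1)) (eps (k - 1))"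
  have "(\<bar>x k $ j\<bar> + (eps k $ j)\<^sup>2) powr p \<le> (\<bar>x (k - 1) $ j\<bar> + (eps (k - 1) $ j)\<^sup>2) powr p
      + ?w j * (\<bar>x k $ j\<bar> - \<bar>x (k - 1) $ j\<bar>)" for j
  proof -
    have "(eps k $ j)\<^sup>2 \<le> (eps (k - 1) $ j)\<^sup>2"
      using eps_antimono[of "k - 1" k j] eps_pos[of k j] by (intro power_mono) auto
    then have "(\<bar>x k $ j\<bar> + (eps k $ j)\<^sup>2) powr p \<le> (\<bar>x k $ j\<bar> + (eps (k - 1) $ j)\<^sup>2) powr p"
      using p by (intro powr_mono2) auto
    also have "\<dots> \<le> (\<bar>x (k - 1) $ j\<bar> + (eps (k - 1) $ j)\<^sup>2) powr p
      + ?w j * ((\<bar>x k $ j\<bar> + (eps (k - 1) $ j)\<^sup>2) - (\<bar>x (k - 1) $ j\<bar> + (eps (k - 1) $ j)\<^sup>2))"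
      unfolding lp_weight_def using eps_pos[of "k - 1" j] p
      by (intro powr_le_tangent) (auto intro!: add_nonneg_pos)
    finally show ?thesis by simp
  qed
  then have "(\<Sum>j\<in>UNIV. (\<bar>x k $ j\<bar> + (eps k $ j)\<^sup>2) powr p) \<le>
      (\<Sum>j\<in>UNIV. (\<bar>x (k - 1) $ j\<bar> + (eps (k - 1) $ j)\<^sup>2) powr p
        + ?w j * (\<bar>x k $ j\<bar> - \<bar>x (k - 1) $ j\<bar>))"
    by (rule sum_mono)
  also have "\<dots> = (\<Sum>j\<in>UNIV. (\<bar>x (k - 1) $ j\<bar> + (eps (k - 1) $ j)\<^sup>2) powr p)
      + (\<Sum>j\<in>UNIV. ?w j * (\<bar>x k $ j\<bar> - \<bar>x (k - 1) $ j\<bar>))"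
    by (rule sum.distrib)
  also have "(\<Sum>j\<in>UNIV. ?w j * (\<bar>x k $ j\<bar> - \<bar>x (k - 1) $ j\<bar>))
      = (\<Sum>j\<in>b k. ?w j * (\<bar>x k $ j\<bar> - \<bar>x (k - 1) $ j\<bar>))"
    using x_keep[OF k] by (intro sum.mono_neutral_right) auto
  finally show ?thesis by simp
qed

text \<open>
  The objective may grow by a multiple of the previous increment of the same block, but the bound
  on \<open>\<beta>\<close> makes that multiple a small fraction of what the previous update has gained.
\<close>

lemma sufficient_decrease:
  assumes k: "1 \<le> k"
  shows "obj k \<le> obj (k - 1) - 5/4 * energy k + 1/4 * energy (last_update b k)"
proof -
  let ?w = "lp_weight p (x (k - 1)) (eps (k - 1))"
  let ?d = "step k" and ?d' = "step (last_update b k)"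
  define P where "P k = (\<Sum>j\<in>UNIV. (\<bar>x k $ j\<bar> + (eps k $ j)\<^sup>2) powr p)" for k
  define W where "W = (\<Sum>j\<in>b k. ?w j * (\<bar>x k $ j\<bar> - \<bar>x (k - 1) $ j\<bar>))"
  have "P k \<le> P (k - 1) + W"
    using penalty_le[OF k] by (simp add: P_def W_def)
  then have pen: "lam * P k \<le> lam * P (k - 1) + lam * W"
    using lam mult_left_mono[of "P k" "P (k - 1) + W" lam] by (simp add: algebra_simps)
  note mod = model_decrease[OF k, folded W_def]
  have "f (x (k - 1) + ?d) \<le> f (x (k - 1)) + gradf (x (k - 1)) \<bullet> ?d + Lip k / 2 * (norm ?d)\<^sup>2"
    by (rule block_descent[OF f_grad Lip_lipschitz[OF k] step_in_block])
  then have desc: "f (x k) \<le> f (x (k - 1)) + gradf (x (k - 1)) \<bullet> ?d + Lip k / 2 * (norm ?d)\<^sup>2"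
    by (simp add: step_def)
  let ?u = "block_part (b k) (x (k - 1))" and ?h = "block_part (b k) (extrap_point k)"
  let ?g = "\<lambda>y. block_part (b k) (gradf (replace_block (x (k - 1)) (b k) y))"
  have r: "replace_block (x (k - 1)) (b k) ?u = x (k - 1)" by (auto simp: vec_eq_iff)
  have uh: "norm (?u - ?h) = \<beta> k * norm ?d'"
  proof -
    have "?u - ?h = - \<beta> k *\<^sub>R ?d'"
      using step_last_update_in_block[of k]
      by (auto simp: extrap_point_def vec_eq_iff coord_space_def)
    then show ?thesis using beta_range[OF k] by simp
  qed
  have "gradf (x (k - 1)) \<bullet> ?d - gradf (extrap_point k) \<bullet> ?d = (?g ?u - ?g ?h) \<bullet> ?d"
    unfolding r replace_block_extrapolated
    by (simp add: inner_diff_left inner_block_part_left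
        block_part_eq_if_coord_space[OF step_in_block])
  also have "\<dots> \<le> norm (?g ?u - ?g ?h) * norm ?d" by (rule norm_cauchy_schwarz)
  also have "\<dots> \<le> (Lip k * (\<beta> k * norm ?d')) * norm ?d"
    using lipschitz_onD[OF Lip_lipschitz[OF k], of ?u ?h] uh
    by (intro mult_right_mono) (auto simp: dist_norm)
  finally have g: "gradf (x (k - 1)) \<bullet> ?d - gradf (extrap_point k) \<bullet> ?d
      \<le> Lip k * \<beta> k * (norm ?d' * norm ?d)" by (simp add: algebra_simps)
  have c: "2 * Lip k * \<beta> k * (?d \<bullet> ?d') \<le> 2 * Lip k * \<beta> k * (norm ?d' * norm ?d)"
    using Lip_pos[OF k] beta_range[OF k] norm_cauchy_schwarz[of ?d ?d']
    by (intro mult_left_mono) (auto simp: mult.commute)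
  \<comment> \<open>The factor 3 collects one cross term from the gradient and two from the proximal term.\<close>
  have cross: "3 * (Lip k * \<beta> k * (norm ?d' * norm ?d)) \<le> 1/4 * energy k + 1/4 * energy (last_update b k)"
  proof (cases "last_update b k = 0")
    case True
    then show ?thesis using energy_nonneg[of k] by (simp add: energy_def)
  next
    case False
    define L1 where "L1 = Lip k"
    define L2 where "L2 = Lip (last_update b k)"
    have pos: "0 < L1" "0 < L2" using Lip_pos k False by (auto simp: L1_def L2_def)
    have "L1 * \<beta> k \<le> L1 * (1/6 * sqrt (L2 / L1))"
      using beta_le[of k] k False pos by (intro mult_left_mono) (auto simp: L1_def L2_def)
    also have "\<dots> = 1/6 * (sqrt L1 * sqrt L2)"
      using pos real_sqrt_mult_self[of L1] by (simp add: real_sqrt_divide field_simps)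
    finally have "L1 * \<beta> k * (norm ?d' * norm ?d) \<le> 1/6 * (sqrt L1 * sqrt L2) * (norm ?d' * norm ?d)"
      by (rule mult_right_mono) simp
    moreover have "0 \<le> (sqrt L1 * norm ?d - sqrt L2 * norm ?d')\<^sup>2" by simp
    moreover have "(sqrt L1 * norm ?d - sqrt L2 * norm ?d')\<^sup>2
        = L1 * (norm ?d)\<^sup>2 + L2 * (norm ?d')\<^sup>2 - 2 * ((sqrt L1 * sqrt L2) * (norm ?d' * norm ?d))"
      using pos by (simp add: power2_diff power_mult_distrib algebra_simps)
    ultimately show ?thesis by (simp add: energy_def L1_def[symmetric] L2_def[symmetric])
  qed
  have "obj k = f (x k) + lam * P k" "obj (k - 1) = f (x (k - 1)) + lam * P (k - 1)"
    by (simp_all add: obj_def smoothed_obj_def P_def)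
  moreover have "energy k = Lip k * (norm ?d)\<^sup>2" by (simp add: energy_def)
  ultimately show ?thesis using pen mod desc g c cross by simp
qed




section \<open>Boundedness and vanishing increments\<close>

lemma obj_antimono: "m \<le> n \<Longrightarrow> obj n \<le> obj m"
proof (rule lift_Suc_antimono_le[of obj])
  show "obj (Suc n) \<le> obj n" for n using monotone_obj[of "Suc n"] by (simp add: obj_def)
qed

lemma continuous_on_f: "continuous_on A f"
proof (rule continuous_at_imp_continuous_on)
  show "\<forall>z\<in>A. isCont f z"
  proof
    fix z
    from f_grad[of z] show "isCont f z"
      unfolding gderiv_def by (rule has_derivative_continuous)
  qed
qed

text \<open>
  Without smoothing the objective is smaller, so all iterates lie in one sublevel set of the
  unsmoothed objective.
\<close>

lemma bounded_iterates: obtains B where "0 < B" "\<And>k. norm (x k) \<le> B"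
proof -
  have "eventually (\<lambda>z. obj 0 < smoothed_obj f lam p z 0) at_infinity"
    using coercive by (simp add: filterlim_at_top_dense)
  then obtain B where B: "0 < B" "\<And>z. B \<le> norm z \<Longrightarrow> obj 0 < smoothed_obj f lam p z 0"
    unfolding eventually_at_infinity_pos by auto
  have "norm (x k) \<le> B" for k
  proof (rule ccontr)
    assume "\<not> norm (x k) \<le> B"
    then have "obj 0 < smoothed_obj f lam p (x k) 0" by (intro B) simp
    also have "\<dots> \<le> obj k"
      unfolding smoothed_obj_def obj_def using lam p
      by (intro add_left_mono mult_left_mono sum_mono powr_mono2) auto
    also have "\<dots> \<le> obj 0" by (rule obj_antimono) simp
    finally show False by simp
  qed
  with B(1) show thesis by (rule that)
qed

lemma obj_bounded_below: obtains c where "\<And>k. c \<le> obj k"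
proof -
  obtain B where B: "0 < B" "\<And>k. norm (x k) \<le> B" using bounded_iterates by blast
  have "\<exists>c\<in>cball 0 B. \<forall>z\<in>cball 0 B. f c \<le> f z"
    by (rule continuous_attains_inf) (use B(1) continuous_on_f in auto)
  then obtain c where c: "\<And>z. z \<in> cball 0 B \<Longrightarrow> f c \<le> f z" by blast
  have "f c \<le> obj k" for k
  proof -
    have "0 \<le> lam * (\<Sum>j\<in>UNIV. (\<bar>x k $ j\<bar> + (eps k $ j)\<^sup>2) powr p)"
      using lam by (intro mult_nonneg_nonneg sum_nonneg) auto
    then show ?thesis using c[of "x k"] B(2)[of k] by (simp add: obj_def smoothed_obj_def)
  qed
  then show thesis by (rule that)
qed

lemma T_pos: "0 < T"
proof -
  obtain j where "j \<in> {1..<1 + T}" using cyclic[OF b_block[of 1], of 1] by blast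
  then show ?thesis by simp
qed

text \<open>The \<open>m\<close>th stretch of \<open>T\<close> consecutive iterations, counted from 1; every block is updated in it.\<close>

definition window :: "nat \<Rightarrow> nat set" where "window m = {m * T - T<..m * T}"

definition window_energy :: "nat \<Rightarrow> real" where "window_energy m = (\<Sum>k\<in>window m. energy k)"

definition wobj :: "nat \<Rightarrow> real" where "wobj m = obj (m * T)"

lemma window_Suc: "window (Suc m) = {m * T<..m * T + T}"
  by (simp add: window_def add.commute)

lemma window_energy_nonneg: "0 \<le> window_energy m"
  by (simp add: window_energy_def sum_nonneg energy_nonneg)

lemma last_update_recent:
  assumes "T < k"
  shows "k - T \<le> last_update b k"
proof -
  have "1 \<le> k" "1 \<le> k - T" using assms by auto
  then obtain j where j: "j \<in> {k - T..<k - T + T}" "b j = b k"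
    using cyclic[OF b_block[of k], of "k - T"] by blast
  then have "j \<le> last_update b k" using assms by (intro le_last_update) auto
  then show ?thesis using j(1) by simp
qed

lemma obj_le_sum:
  assumes "m \<le> n"
  shows "obj n \<le> obj m - 5/4 * (\<Sum>k\<in>{m<..n}. energy k) + 1/4 * (\<Sum>k\<in>{m<..n}. energy (last_update b k))"
  using assms
proof (induction n rule: dec_induct)
  case (step n)
  have "{m<..Suc n} = insert (Suc n) {m<..n}" using step.hyps by auto
  then show ?case using step.IH sufficient_decrease[of "Suc n"] by (simp add: field_simps)
qed simp

text \<open>
  The updates preceding those of one window are distinct iterations of this window or of the one
  before it, so the positive terms in the decrease estimate are paid for by their own window up to
  a quarter of the energy of the previous one.
\<close>

lemma window_decrease:
  assumes "1 \<le> m"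
  shows "window_energy (Suc m) \<le> 1/4 * window_energy m + (wobj m - wobj (Suc m))"
proof -
  obtain n where n: "m = Suc n" using assms by (cases m) auto
  let ?W = "window (Suc m)"
  have pr: "1 \<le> last_update b k \<and> last_update b k \<in> window m \<union> window (Suc m)" if "k \<in> ?W" for k
  proof -
    have k: "T + n * T < k" "k \<le> T + (T + n * T)" using that by (auto simp: window_Suc n)
    then show ?thesis
      using last_update_recent[of k] last_update_less[of k b] n
      by (auto simp: window_Suc)
  qed
  have inj: "inj_on (last_update b) ?W"
    using pr by (intro inj_on_subset[OF inj_on_last_update]) auto
  have "(\<Sum>k\<in>?W. energy (last_update b k)) = (\<Sum>j\<in>last_update b ` ?W. energy j)"
    by (simp add: sum.reindex[OF inj])
  also have "\<dots> \<le> (\<Sum>j\<in>window m \<union> window (Suc m). energy j)"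
  proof (rule sum_mono2)
    show "last_update b ` ?W \<subseteq> window m \<union> window (Suc m)" using pr by blast
  qed (auto simp: window_def energy_nonneg)
  also have "\<dots> = window_energy m + window_energy (Suc m)"
    unfolding window_energy_def by (rule sum.union_disjoint) (auto simp: window_Suc n)
  finally have "(\<Sum>k\<in>?W. energy (last_update b k)) \<le> window_energy m + window_energy (Suc m)" .
  moreover have "wobj (Suc m) \<le> wobj m - 5/4 * window_energy (Suc m)
      + 1/4 * (\<Sum>k\<in>?W. energy (last_update b k))"
    using obj_le_sum[of "m * T" "m * T + T"]
    by (simp add: wobj_def window_energy_def window_Suc add.commute)
  ultimately show ?thesis by simp
qed

lemma wobj_antimono: "m \<le> n \<Longrightarrow> wobj n \<le> wobj m"
  unfolding wobj_def by (intro obj_antimono) simp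

text \<open>The objective plus half of the window energy is a decreasing Lyapunov function.\<close>

lemma window_energy_tendsto_0: "window_energy \<longlonglongrightarrow> 0"
proof -
  define P where "P m = wobj (Suc m) + 1/2 * window_energy (Suc m)" for m
  have dec: "window_energy (Suc (Suc m)) \<le> 2 * (P m - P (Suc m))" for m
    using window_decrease[of "Suc m"] window_energy_nonneg[of "Suc m"] by (simp add: P_def)
  obtain c where c: "\<And>k. c \<le> obj k" using obj_bounded_below by blast
  have low: "c \<le> P m" for m
    using c[of "Suc m * T"] window_energy_nonneg[of "Suc m"] by (simp add: P_def wobj_def)
  have "P (Suc m) \<le> P m" for m
    using dec[of m] window_energy_nonneg[of "Suc (Suc m)"] by simp
  then obtain P0 where P0: "P \<longlonglongrightarrow> P0"
    using decseq_convergent[of P c] low unfolding decseq_Suc_iff by blast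
  have "(\<lambda>m. 2 * (P m - P (Suc m))) \<longlonglongrightarrow> 2 * (P0 - P0)"
    by (intro tendsto_intros P0 LIMSEQ_Suc)
  then have lim: "(\<lambda>m. 2 * (P m - P (Suc m))) \<longlonglongrightarrow> 0" by simp
  have "(\<lambda>m. window_energy (Suc (Suc m))) \<longlonglongrightarrow> 0"
    by (rule tendsto_sandwich[OF _ _ tendsto_const[of 0] lim])
      (use dec window_energy_nonneg in \<open>auto intro!: always_eventually\<close>)
  then show ?thesis
    by (rule LIMSEQ_imp_Suc[OF LIMSEQ_imp_Suc])
qed

lemma norm_step_le_window:
  assumes "k \<in> window m"
  shows "norm (step k) \<le> sqrt (window_energy m / l)"
proof -
  have k: "1 \<le> k" using assms by (auto simp: window_def)
  have "l * (norm (step k))\<^sup>2 \<le> energy k"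
    unfolding energy_def using Lip_range[OF k] by (intro mult_right_mono) auto
  also have "\<dots> \<le> window_energy m"
    unfolding window_energy_def using assms
    by (intro member_le_sum) (auto simp: window_def energy_nonneg)
  finally have "(norm (step k))\<^sup>2 \<le> window_energy m / l" using l_pos by (simp add: field_simps)
  then show ?thesis by (rule real_le_rsqrt)
qed


section \<open>Optimality conditions and stabilisation of the support\<close>

text \<open>
  Perturbing only the coordinate \<open>i\<close>, by less than its modulus, changes the model by a quadratic
  polynomial whose slope at 0 is the left-hand side.
\<close>

lemma optimality:
  assumes k: "1 \<le> k" and i: "i \<in> b k" and nz: "x k $ i \<noteq> 0"
  shows "gradf (extrap_point k) $ i + 2 * Lip k * (x k $ i - extrap_point k $ i)
     + lam * lp_weight p (x (k - 1)) (eps (k - 1)) i * sgn (x k $ i) = 0"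
proof (rule zero_slope_if_local_min_quadratic)
  let ?w = "lp_weight p (x (k - 1)) (eps (k - 1))"
  let ?g = "block_part (b k) (gradf (extrap_point k))"
  let ?h = "block_part (b k) (extrap_point k)"
  let ?y = "block_part (b k) (x k)"
  let ?M = "block_model gradf lam p b \<alpha> \<beta> x eps k"
  show "0 < \<bar>x k $ i\<bar>" using nz by simp
  fix t :: real assume t: "\<bar>t\<bar> < \<bar>x k $ i\<bar>"
  let ?z = "?y + axis i t"
  have "?z \<in> coord_space (b k)" using i by (auto simp: coord_space_def axis_def)
  then have min: "?M ?y \<le> ?M ?z" using x_update[OF k] by (auto simp: is_arg_min_def not_less)
  have inner: "?g \<bullet> ?z = ?g \<bullet> ?y + t * gradf (extrap_point k) $ i"
    using i by (simp add: inner_add_right inner_axis)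
  have na: "(norm (axis i t :: real ^ 'n))\<^sup>2 = t\<^sup>2"
    by (simp only: power2_norm_eq_inner inner_axis) (simp add: axis_def power2_eq_square)
  have "?z - ?h = (?y - ?h) + axis i t" by simp
  then have "(norm (?z - ?h))\<^sup>2 = (norm (?y - ?h))\<^sup>2 + 2 * ((?y - ?h) \<bullet> axis i t) + (norm (axis i t :: real ^ 'n))\<^sup>2"
    by (simp only: power2_norm_eq_inner) (simp add: inner_add_left inner_add_right inner_commute)
  then have n: "(norm (?z - ?h))\<^sup>2 = (norm (?y - ?h))\<^sup>2 + 2 * t * (x k $ i - extrap_point k $ i) + t\<^sup>2"
    using i by (simp only: na) (simp add: inner_axis)
  have "\<bar>x k $ i + t\<bar> = \<bar>x k $ i\<bar> + t * sgn (x k $ i)"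
    using t by (auto simp: abs_if sgn_if split: if_splits)
  then have "(\<Sum>j\<in>b k. ?w j * \<bar>?z $ j\<bar>) = (\<Sum>j\<in>b k. ?w j * \<bar>?y $ j\<bar>) + ?w i * (t * sgn (x k $ i))"
    using i by (simp add: sum.remove[OF _ i] axis_def algebra_simps)
  then have s: "lam * (\<Sum>j\<in>b k. ?w j * \<bar>?z $ j\<bar>)
      = lam * (\<Sum>j\<in>b k. ?w j * \<bar>?y $ j\<bar>) + t * (lam * ?w i * sgn (x k $ i))"
    by (simp add: algebra_simps)
  show "0 \<le> t * (gradf (extrap_point k) $ i + 2 * Lip k * (x k $ i - extrap_point k $ i)
     + lam * ?w i * sgn (x k $ i)) + Lip k * t\<^sup>2"
    using min unfolding block_model_eq[OF k] inner n s by (simp add: algebra_simps)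
qed

lemma norm_step_le:
  assumes "\<And>k. norm (x k) \<le> B"
  shows "norm (step k) \<le> 2 * B"
  using norm_triangle_ineq4[of "x k" "x (k - 1)"] assms[of k] assms[of "k - 1"]
  by (simp add: step_def)

text \<open>
  By the optimality condition a coordinate that is nonzero after its update has had a bounded
  weight, because gradients and increments stay bounded; as the exponent \<open>p - 1\<close> is negative, the
  argument of the weight was bounded away from zero.
\<close>

lemma weight_argument_lower_bound:
  obtains c where "0 < c"
    "\<And>k i. 1 \<le> k \<Longrightarrow> i \<in> b k \<Longrightarrow> x k $ i \<noteq> 0 \<Longrightarrow> c \<le> \<bar>x (k - 1) $ i\<bar> + (eps (k - 1) $ i)\<^sup>2"
proof -
  obtain B where B: "0 < B" "\<And>k. norm (x k) \<le> B" using bounded_iterates by blast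
  have "compact (gradf ` cball 0 (3 * B))"
    by (intro compact_continuous_image continuous_on_subset[OF gradf_cont]) auto
  then have "bounded (gradf ` cball 0 (3 * B))" by (rule compact_imp_bounded)
  then obtain G where G: "0 < G" "\<And>z. z \<in> cball 0 (3 * B) \<Longrightarrow> norm (gradf z) \<le> G"
    unfolding bounded_pos by blast
  have L: "0 < L" using Lip_range[of 1] l_pos by simp
  \<comment> \<open>a bound for gradient and proximal term, relative to \<open>lam * p\<close>; extrapolated points
    have norm at most \<open>B + 2 * B\<close>\<close>
  define C where "C = (G + 2 * L * (B + 3 * B)) / (lam * p)"
  have C: "0 < C" using G B L lam p by (simp add: C_def add_pos_pos)
  \<comment> \<open>the argument at which the power \<open>p - 1\<close> takes the value \<open>C\<close>\<close>
  define c where "c = C powr (1 / (p - 1))"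
  have c: "0 < c" using C by (simp add: c_def)
  have cC: "c powr (p - 1) = C" using C p by (simp add: c_def powr_powr)
  have "c \<le> \<bar>x (k - 1) $ i\<bar> + (eps (k - 1) $ i)\<^sup>2" (is "_ \<le> ?t")
    if k: "1 \<le> k" and i: "i \<in> b k" and nz: "x k $ i \<noteq> 0" for k i
  proof (rule ccontr)
    assume "\<not> c \<le> ?t"
    then have t: "?t < c" "0 < ?t" using eps_pos[of "k - 1" i] by (auto intro!: add_nonneg_pos)
    have "C < ?t powr (p - 1)"
      using powr_less_mono2_neg[of "p - 1" ?t c] t p cC by simp
    moreover have "?t powr (p - 1) \<le> C"
    proof -
      let ?e = "extrap_point k"
      have "norm ?e \<le> norm (x (k - 1)) + norm (\<beta> k *\<^sub>R step (last_update b k))"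
        unfolding extrap_point_def by (rule norm_triangle_ineq)
      also have "\<dots> \<le> B + 1 * (2 * B)"
      proof (rule add_mono)
        have "\<beta> k * norm (step (last_update b k)) \<le> 1 * (2 * B)"
          by (rule mult_mono) (use beta_range[OF k] norm_step_le[OF B(2)] in auto)
        then show "norm (\<beta> k *\<^sub>R step (last_update b k)) \<le> 1 * (2 * B)"
          using beta_range[OF k] by simp
      qed (rule B(2))
      finally have e: "norm ?e \<le> 3 * B" by simp
      have "lam * lp_weight p (x (k - 1)) (eps (k - 1)) i
          = \<bar>lam * lp_weight p (x (k - 1)) (eps (k - 1)) i * sgn (x k $ i)\<bar>"
        using lam lp_weight_nonneg[of "x (k - 1)" "eps (k - 1)" i] nz
        by (simp add: abs_mult abs_sgn_eq)
      also have "\<dots> = \<bar>gradf ?e $ i + 2 * Lip k * (x k $ i - ?e $ i)\<bar>"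
        using optimality[OF k i nz] by linarith
      also have "\<dots> \<le> \<bar>gradf ?e $ i\<bar> + 2 * Lip k * (\<bar>x k $ i\<bar> + \<bar>?e $ i\<bar>)"
        using Lip_pos[OF k] by (intro order_trans[OF abs_triangle_ineq]) (simp add: abs_mult abs_triangle_ineq4)
      also have "\<dots> \<le> G + 2 * L * (B + 3 * B)"
        using Lip_range[OF k] l_pos B(1) order_trans[OF component_le_norm_cart B(2), of k i]
          order_trans[OF component_le_norm_cart e, of i]
          order_trans[OF component_le_norm_cart G(2), of ?e i] e
        by (intro add_mono mult_mono) auto
      finally show ?thesis
        using lam p by (simp add: lp_weight_def C_def field_simps)
    qed
    ultimately show False by simp
  qed
  with c show thesis by (rule that)
qed

lemma next_update:
  obtains k' where "k < k'" "i \<in> b k'" "x (k' - 1) $ i = x k $ i"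
proof -
  have "\<Union>S = UNIV" using blocks by (simp add: partition_on_def)
  then obtain s where s: "s \<in> S" "i \<in> s" by (metis UNIV_I UnionE)
  obtain j where j: "j \<in> {Suc k..<Suc k + T}" "b j = s" using cyclic[OF s(1), of "Suc k"] by auto
  define k' where "k' = (LEAST j. k < j \<and> i \<in> b j)"
  have k': "k < k' \<and> i \<in> b k'"
    unfolding k'_def by (rule LeastI[of _ j]) (use j s in auto)
  have least: "k' \<le> j" if "k < j" "i \<in> b j" for j
    unfolding k'_def by (rule Least_le) (use that in auto)
  have "x (k' - 1) $ i = x k $ i"
    by (rule coordinate_const) (use k' least in force)+
  with k' show thesis by (intro that) auto
qed

text \<open>
  Each time the coordinate is nonzero its smoothing parameter shrinks by a fixed factor, and it never
  grows.
\<close>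

lemma eps_tendsto_0:
  assumes inf: "frequently (\<lambda>k. x k $ i \<noteq> 0) sequentially"
  shows "(\<lambda>k. eps k $ i) \<longlonglongrightarrow> 0"
proof -
  have "decseq (\<lambda>k. eps k $ i)" "\<forall>k. 0 \<le> eps k $ i"
    using eps_pos eps_Suc_le by (auto simp: decseq_Suc_iff intro: less_imp_le)
  then obtain e where e: "(\<lambda>k. eps k $ i) \<longlonglongrightarrow> e" "\<forall>k. e \<le> eps k $ i"
    using decseq_convergent by blast
  have "e \<le> 0"
  proof (rule ccontr)
    assume "\<not> e \<le> 0"
    then have "e < e / sqrt \<mu>" using mu by (simp add: field_simps)
    then have "eventually (\<lambda>k. eps k $ i < e / sqrt \<mu>) sequentially"
      using e(1) by (intro order_tendstoD(2)) auto
    then obtain N where N: "\<And>k. N \<le> k \<Longrightarrow> eps k $ i < e / sqrt \<mu>"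
      by (auto simp: eventually_sequentially)
    obtain k where k: "Suc N \<le> k" "x k $ i \<noteq> 0"
      using inf by (auto simp: frequently_sequentially)
    then obtain k0 where k0: "k = Suc k0" "N \<le> k0" by (cases k) auto
    have "eps k $ i \<le> sqrt \<mu> * eps k0 $ i" using eps_shrink[of k0 i] k k0 by simp
    also have "\<dots> < e" using N[OF k0(2)] mu by (simp add: field_simps)
    finally show False using e(2) by (simp add: not_le[symmetric])
  qed
  moreover have "0 \<le> e" using e(1) eps_pos by (intro LIMSEQ_le_const) (auto intro: less_imp_le)
  ultimately show ?thesis using e(1) by simp
qed

text \<open>
  Once the smoothing parameter is small, a coordinate at zero stays there: leaving zero would need a
  bounded weight, whereas the weight at zero is large.
\<close>

lemma coordinate_eventually_nonzero:
  assumes inf: "frequently (\<lambda>k. x k $ i \<noteq> 0) sequentially"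
  shows "eventually (\<lambda>k. x k $ i \<noteq> 0) sequentially"
proof -
  obtain c where c: "0 < c" "\<And>k i. 1 \<le> k \<Longrightarrow> i \<in> b k \<Longrightarrow> x k $ i \<noteq> 0 \<Longrightarrow>
      c \<le> \<bar>x (k - 1) $ i\<bar> + (eps (k - 1) $ i)\<^sup>2"
    using weight_argument_lower_bound by blast
  have "(\<lambda>k. (eps k $ i)\<^sup>2) \<longlonglongrightarrow> 0\<^sup>2" by (intro tendsto_intros eps_tendsto_0[OF inf])
  then have "eventually (\<lambda>k. (eps k $ i)\<^sup>2 < c) sequentially"
    using c(1) by (intro order_tendstoD(2)) auto
  then obtain N where N: "\<And>k. N \<le> k \<Longrightarrow> (eps k $ i)\<^sup>2 < c"
    by (auto simp: eventually_sequentially)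
  have stay: "x (Suc k) $ i = 0" if "N \<le> k" "x k $ i = 0" for k
  proof (rule ccontr)
    assume nz: "x (Suc k) $ i \<noteq> 0"
    then have "i \<in> b (Suc k)" using x_keep[of "Suc k" i] that(2) by auto
    then show False using c(2)[of "Suc k" i] nz N[OF that(1)] that(2) by simp
  qed
  have "x k $ i \<noteq> 0" if k: "N \<le> k" for k
  proof
    assume 0: "x k $ i = 0"
    have "x n $ i = 0" if "k \<le> n" for n
      using that by (induction n rule: dec_induct) (use 0 k stay in auto)
    then show False using inf by (auto simp: frequently_sequentially)
  qed
  then show ?thesis by (auto simp: eventually_sequentially)
qed

abbreviation I :: "'n set" where "I \<equiv> eventual_support x"

text \<open>Since there are finitely many coordinates, the support as a whole settles.\<close>

lemma eventually_supp_idx: "eventually (\<lambda>k. supp_idx (x k) = I) sequentially"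
proof -
  define I' where "I' = {i. frequently (\<lambda>k. x k $ i \<noteq> 0) sequentially}"
  have "eventually (\<lambda>k. \<forall>i\<in>UNIV. (x k $ i \<noteq> 0) = (i \<in> I')) sequentially"
  proof (rule eventually_ball_finite)
    show "\<forall>i\<in>UNIV. eventually (\<lambda>k. (x k $ i \<noteq> 0) = (i \<in> I')) sequentially"
    proof
      fix i
      show "eventually (\<lambda>k. (x k $ i \<noteq> 0) = (i \<in> I')) sequentially"
      proof (cases "i \<in> I'")
        case True
        then show ?thesis using coordinate_eventually_nonzero[of i] by (simp add: I'_def)
      next
        case False
        then have "eventually (\<lambda>k. x k $ i = 0) sequentially" by (simp add: I'_def not_frequently)
        then show ?thesis by eventually_elim (use False in simp)
      qed
    qed
  qed simp
  then have ev: "eventually (\<lambda>k. supp_idx (x k) = I') sequentially"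
    by eventually_elim (auto simp: supp_idx_def)
  have "I = I'"
    unfolding eventual_support_def
  proof (rule the_equality)
    show "eventually (\<lambda>k. supp_idx (x k) = I') sequentially" by (fact ev)
    fix J assume "eventually (\<lambda>k. supp_idx (x k) = J) sequentially"
    with ev have "eventually (\<lambda>k. J = I') sequentially" by eventually_elim auto
    then show "J = I'" by simp
  qed
  with ev show ?thesis by simp
qed

end


section \<open>The gradient of the reduced function\<close>

definition reduced_grad ::
  "(real ^ 'n \<Rightarrow> real ^ 'n) \<Rightarrow> real \<Rightarrow> real \<Rightarrow> 'n set \<Rightarrow> real ^ 'n \<Rightarrow> real ^ 'n \<Rightarrow> (real ^ 'n) \<times> (real ^ 'n::finite)"
  where "reduced_grad gradf lam p J z e =
    (\<chi> i. if i \<in> J then gradf z $ i + lam * (p * (\<bar>z $ i\<bar> + (e $ i)\<^sup>2) powr (p - 1) * sgn (z $ i)) else 0,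
     \<chi> i. if i \<in> J then lam * (p * (\<bar>z $ i\<bar> + (e $ i)\<^sup>2) powr (p - 1) * (2 * e $ i)) else 0)"

lemma reduced_grad_in_subspace: "reduced_grad gradf lam p J z e \<in> coord_space J \<times> coord_space J"
  by (simp add: reduced_grad_def coord_space_def)

lemma bounded_linear_block_part: "bounded_linear (block_part J :: real ^ 'n \<Rightarrow> real ^ 'n::finite)"
  unfolding linear_conv_bounded_linear[symmetric]
  by (rule linearI) (auto simp: vec_eq_iff)

lemma has_derivative_abs_coordinate:
  fixes z e :: "real ^ 'n::finite"
  assumes nz: "z $ i \<noteq> 0"
  shows "((\<lambda>w. \<bar>fst w $ i\<bar>) has_derivative (\<lambda>h. sgn (z $ i) * fst h $ i)) (at (z, e))"
proof (rule has_derivative_transform_within)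
  have lin: "bounded_linear (\<lambda>w :: (real ^ 'n) \<times> (real ^ 'n). fst w $ i)"
    by (intro bounded_linear_compose[OF bounded_linear_vec_nth bounded_linear_fst])
  show "((\<lambda>w. sgn (z $ i) * fst w $ i) has_derivative (\<lambda>h. sgn (z $ i) * fst h $ i)) (at (z, e))"
    by (intro has_derivative_mult_right bounded_linear_imp_has_derivative lin)
  show "0 < \<bar>z $ i\<bar>" using nz by simp
  fix w :: "(real ^ 'n) \<times> (real ^ 'n)" assume d: "dist w (z, e) < \<bar>z $ i\<bar>"
  have "\<bar>fst w $ i - z $ i\<bar> \<le> norm (fst w - z)"
    using component_le_norm_cart[of "fst w - z" i] by simp
  also have "\<dots> \<le> dist w (z, e)" using dist_fst_le[of w "(z, e)"] by (simp add: dist_norm)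
  finally show "sgn (z $ i) * fst w $ i = \<bar>fst w $ i\<bar>"
    using d by (auto simp: sgn_if abs_if split: if_splits)
qed simp

lemma has_derivative_penalty_term:
  fixes z e :: "real ^ 'n::finite" and p :: real
  assumes nz: "z $ i \<noteq> 0"
  shows "((\<lambda>w. (\<bar>fst w $ i\<bar> + (snd w $ i)\<^sup>2) powr p) has_derivative
    (\<lambda>h. (sgn (z $ i) * fst h $ i + 2 * e $ i * snd h $ i) * (p * (\<bar>z $ i\<bar> + (e $ i)\<^sup>2) powr (p - 1))))
    (at (z, e))"
proof (rule has_derivative_compose[where g = "\<lambda>s. s powr p"
      and f = "\<lambda>w. \<bar>fst w $ i\<bar> + (snd w $ i)\<^sup>2"
      and f' = "\<lambda>h. sgn (z $ i) * fst h $ i + 2 * e $ i * snd h $ i"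
      and g' = "\<lambda>s. s * (p * (\<bar>z $ i\<bar> + (e $ i)\<^sup>2) powr (p - 1))"])
  have "bounded_linear (\<lambda>w :: (real ^ 'n) \<times> (real ^ 'n). snd w $ i)"
    by (intro bounded_linear_compose[OF bounded_linear_vec_nth bounded_linear_snd])
  then have "((\<lambda>w. snd w $ i) has_derivative (\<lambda>h. snd h $ i)) (at (z, e))"
    by (rule bounded_linear_imp_has_derivative)
  from has_derivative_power[OF this, of 2]
  have "((\<lambda>w. (snd w $ i)\<^sup>2) has_derivative (\<lambda>h. 2 * e $ i * snd h $ i)) (at (z, e))"
    by (simp add: algebra_simps)
  with has_derivative_abs_coordinate[OF nz]
  show "((\<lambda>w. \<bar>fst w $ i\<bar> + (snd w $ i)\<^sup>2) has_derivative
      (\<lambda>h. sgn (z $ i) * fst h $ i + 2 * e $ i * snd h $ i)) (at (z, e))"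
    by (rule has_derivative_add)
  have "0 < \<bar>z $ i\<bar> + (e $ i)\<^sup>2" using nz by (intro add_pos_nonneg) auto
  from has_real_derivative_powr[OF this, of p]
  show "((\<lambda>s. s powr p) has_derivative (\<lambda>s. s * (p * (\<bar>z $ i\<bar> + (e $ i)\<^sup>2) powr (p - 1))))
      (at (\<bar>fst (z, e) $ i\<bar> + (snd (z, e) $ i)\<^sup>2))"
    by (simp add: has_field_derivative_def mult_commute_abs)
qed

text \<open>
  The reduced function is differentiable wherever no coordinate in \<open>J\<close> vanishes: the kink of the
  absolute value is avoided and the argument of the power is positive.
\<close>

lemma reduced_obj_has_derivative:
  fixes f :: "real ^ 'n::finite \<Rightarrow> real"
  assumes grad: "\<And>z. GDERIV f z :> gradf z" and z: "z \<in> coord_space J"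
    and nz: "\<And>i. i \<in> J \<Longrightarrow> z $ i \<noteq> 0"
  shows "(reduced_obj f lam p J has_derivative (\<lambda>h. reduced_grad gradf lam p J z e \<bullet> h)) (at (z, e))"
proof -
  let ?t = "\<lambda>j. p * (\<bar>z $ j\<bar> + (e $ j)\<^sup>2) powr (p - 1)"
  let ?P = "\<lambda>h j. (sgn (z $ j) * fst h $ j + 2 * e $ j * snd h $ j) * ?t j"
  have "bounded_linear (\<lambda>w :: (real ^ 'n) \<times> (real ^ 'n). block_part J (fst w))"
    by (intro bounded_linear_compose[OF bounded_linear_block_part bounded_linear_fst])
  then have "((\<lambda>w. block_part J (fst w)) has_derivative (\<lambda>h. block_part J (fst h))) (at (z, e))"
    by (rule bounded_linear_imp_has_derivative)
  moreover have "(f has_derivative (\<lambda>h. h \<bullet> gradf z)) (at (block_part J (fst (z, e))))"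
    using grad[of z] by (simp add: gderiv_def block_part_eq_if_coord_space[OF z])
  ultimately have "((\<lambda>w. f (block_part J (fst w))) has_derivative (\<lambda>h. block_part J (fst h) \<bullet> gradf z)) (at (z, e))"
    by (rule has_derivative_compose)
  moreover have "((\<lambda>w. lam * (\<Sum>j\<in>J. (\<bar>fst w $ j\<bar> + (snd w $ j)\<^sup>2) powr p)) has_derivative
      (\<lambda>h. lam * (\<Sum>j\<in>J. ?P h j))) (at (z, e))"
    by (intro has_derivative_mult_right has_derivative_sum has_derivative_penalty_term nz)
  ultimately have der: "((\<lambda>w. f (block_part J (fst w)) + lam * (\<Sum>j\<in>J. (\<bar>fst w $ j\<bar> + (snd w $ j)\<^sup>2) powr p))
      has_derivative (\<lambda>h. block_part J (fst h) \<bullet> gradf z + lam * (\<Sum>j\<in>J. ?P h j))) (at (z, e))"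
    by (rule has_derivative_add)
  have "block_part J (fst h) \<bullet> gradf z + lam * (\<Sum>j\<in>J. ?P h j) = reduced_grad gradf lam p J z e \<bullet> h" for h
  proof -
    have "(\<Sum>j\<in>J. ?P h j) = (\<Sum>j\<in>UNIV. if j \<in> J then ?P h j else 0)"
      by (simp add: sum.If_cases)
    then have "block_part J (fst h) \<bullet> gradf z + lam * (\<Sum>j\<in>J. ?P h j)
        = (\<Sum>j\<in>UNIV. block_part J (fst h) $ j * gradf z $ j + lam * (if j \<in> J then ?P h j else 0))"
      by (simp add: inner_vec_def sum.distrib sum_distrib_left)
    also have "\<dots> = (\<Sum>j\<in>UNIV. fst (reduced_grad gradf lam p J z e) $ j * fst h $ j
        + snd (reduced_grad gradf lam p J z e) $ j * snd h $ j)"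
      by (intro sum.cong) (auto simp: reduced_grad_def algebra_simps)
    also have "\<dots> = reduced_grad gradf lam p J z e \<bullet> h"
      by (simp add: inner_prod_def inner_vec_def sum.distrib)
    finally show ?thesis .
  qed
  with der show ?thesis
    by (simp add: reduced_obj_def case_prod_unfold)
qed

lemma continuous_reduced_obj:
  fixes f :: "real ^ 'n::finite \<Rightarrow> real"
  assumes f: "continuous_on UNIV f" and p: "0 < p"
  shows "isCont (reduced_obj f lam p J) w"
proof -
  have "isCont (\<lambda>w. f (block_part J (fst w))) w"
  proof (rule isCont_o2[where g = f])
    show "isCont (\<lambda>w. block_part J (fst w)) w"
      by (intro bounded_linear.isCont[OF bounded_linear_block_part] continuous_intros)
    show "isCont f (block_part J (fst w))" using f by (simp add: continuous_on_eq_continuous_at)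
  qed
  moreover have "isCont (\<lambda>w :: (real ^ 'n) \<times> (real ^ 'n). (\<bar>fst w $ j\<bar> + (snd w $ j)\<^sup>2) powr p) w" for j
    unfolding isCont_def using p
    by (intro tendsto_powr' tendsto_intros) auto
  ultimately have "isCont (\<lambda>w. f (block_part J (fst w)) + lam * (\<Sum>j\<in>J. (\<bar>fst w $ j\<bar> + (snd w $ j)\<^sup>2) powr p)) w"
    by (intro continuous_add continuous_mult continuous_const continuous_sum) auto
  then show ?thesis by (simp add: reduced_obj_def case_prod_unfold)
qed

context extrapolated_block_descent
begin

section \<open>Behaviour on the final support\<close>

abbreviation reduced :: "(real ^ 'n) \<times> (real ^ 'n) \<Rightarrow> real" where
  "reduced \<equiv> reduced_obj f lam p I"

text \<open>The smoothing parameters outside \<open>I\<close> do not tend to zero. They are replaced by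
  zero, so that the sequence accumulates at a point with vanishing second component.\<close>

definition Z :: "nat \<Rightarrow> (real ^ 'n) \<times> (real ^ 'n)" where "Z k = (x k, block_part I (eps k))"

text \<open>On the final support, \<open>T\<close> iterations shrink the smoothing parameters by this factor.\<close>

definition rate :: real where "rate = sqrt \<mu> ^ T"

lemma sqrt_mu: "0 < sqrt \<mu>" "sqrt \<mu> < 1"
  using mu by auto

lemma rate: "0 < rate" "rate < 1"
  using sqrt_mu T_pos by (simp_all add: rate_def power_Suc_less_one power_less_one_iff)

text \<open>
  The lower bound holds just before the next update of the coordinate, and until then the
  coordinate keeps its value while its smoothing parameter can only shrink. A coordinate that stays
  nonzero has its smoothing parameter shrunk in every iteration, hence the geometric decay.
\<close>

lemma final_support_behaviour:
  obtains N c E where "0 < c" "0 \<le> E" "\<And>k. N \<le> k \<Longrightarrow> supp_idx (x k) = I"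
    "\<And>k i. N \<le> k \<Longrightarrow> i \<in> I \<Longrightarrow> c \<le> \<bar>x k $ i\<bar> + (eps k $ i)\<^sup>2"
    "\<And>k i. N \<le> k \<Longrightarrow> i \<in> I \<Longrightarrow> eps k $ i \<le> E * sqrt \<mu> ^ k"
proof -
  obtain N where N: "\<And>k. N \<le> k \<Longrightarrow> supp_idx (x k) = I"
    using eventually_supp_idx by (auto simp: eventually_sequentially)
  obtain c where c: "0 < c" "\<And>k i. 1 \<le> k \<Longrightarrow> i \<in> b k \<Longrightarrow> x k $ i \<noteq> 0 \<Longrightarrow>
      c \<le> \<bar>x (k - 1) $ i\<bar> + (eps (k - 1) $ i)\<^sup>2"
    using weight_argument_lower_bound by blast
  define E where "E = (\<Sum>i\<in>UNIV. eps N $ i / sqrt \<mu> ^ N)"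
  have E: "0 \<le> E" unfolding E_def using eps_pos sqrt_mu by (intro sum_nonneg) (auto intro: less_imp_le)
  have low: "c \<le> \<bar>x k $ i\<bar> + (eps k $ i)\<^sup>2" if k: "N \<le> k" "i \<in> I" for k i
  proof -
    obtain k' where k': "k < k'" "i \<in> b k'" "x (k' - 1) $ i = x k $ i" using next_update by blast
    have "i \<in> supp_idx (x k')" using N[of k'] k k' by simp
    then have "c \<le> \<bar>x k $ i\<bar> + (eps (k' - 1) $ i)\<^sup>2"
      using c(2)[of k' i] k' by (simp add: supp_idx_def)
    also have "(eps (k' - 1) $ i)\<^sup>2 \<le> (eps k $ i)\<^sup>2"
      using eps_antimono[of k "k' - 1" i] eps_pos[of "k' - 1" i] k' by (intro power_mono) auto
    finally show ?thesis by simp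
  qed
  have geo: "eps k $ i \<le> E * sqrt \<mu> ^ k" if "N \<le> k" "i \<in> I" for k i
    using that(1)
  proof (induction k rule: dec_induct)
    case base
    have "eps N $ i / sqrt \<mu> ^ N \<le> E"
      unfolding E_def using eps_pos sqrt_mu
      by (intro member_le_sum) (auto intro: less_imp_le)
    then show ?case using sqrt_mu by (simp add: field_simps)
  next
    case (step k)
    have "i \<in> supp_idx (x (Suc k))" using N[of "Suc k"] step.hyps \<open>i \<in> I\<close> by simp
    then have "eps (Suc k) $ i \<le> sqrt \<mu> * eps k $ i" using eps_shrink[of k i] by (simp add: supp_idx_def)
    also have "\<dots> \<le> sqrt \<mu> * (E * sqrt \<mu> ^ k)" using step.IH sqrt_mu by (intro mult_left_mono) auto
    finally show ?case by (simp add: algebra_simps)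
  qed
  show thesis by (rule that[OF c(1) E N low geo])
qed

lemma x_in_coord_space: "supp_idx (x k) = I \<Longrightarrow> x k \<in> coord_space I"
  by (auto simp: coord_space_def supp_idx_def)

text \<open>
  Coordinates outside the final support stay at zero with frozen smoothing parameters, so their
  share of the objective is constant.
\<close>

lemma obj_diff_eq_reduced_diff:
  assumes N: "\<And>k. N \<le> k \<Longrightarrow> supp_idx (x k) = I" and k: "N \<le> k"
  shows "obj k - reduced (Z k) = obj N - reduced (Z N)"
proof -
  have "obj k - reduced (Z k) = lam * (\<Sum>j\<in>-I. ((eps N $ j)\<^sup>2) powr p)" if k: "N \<le> k" for k
  proof -
    have eps: "eps k $ j = eps N $ j" if "j \<notin> I" for j
      using k
    proof (induction k rule: dec_induct)
      case (step k)
      have "j \<notin> supp_idx (x (Suc k))" using N[of "Suc k"] step.hyps that by simp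
      then show ?case using step.IH eps_keep[of k j] by (simp add: supp_idx_def)
    qed simp
    have "x k $ j = 0" if "j \<notin> I" for j
      using x_in_coord_space[OF N[OF k]] that by (simp add: coord_space_def)
    then have out: "(\<Sum>j\<in>-I. (\<bar>x k $ j\<bar> + (eps k $ j)\<^sup>2) powr p) = (\<Sum>j\<in>-I. ((eps N $ j)\<^sup>2) powr p)"
      using eps by (intro sum.cong) auto
    have "(\<Sum>j\<in>UNIV. (\<bar>x k $ j\<bar> + (eps k $ j)\<^sup>2) powr p)
        = (\<Sum>j\<in>I. (\<bar>x k $ j\<bar> + (eps k $ j)\<^sup>2) powr p) + (\<Sum>j\<in>-I. (\<bar>x k $ j\<bar> + (eps k $ j)\<^sup>2) powr p)"
      using sum.union_disjoint[of I "- I"] by (simp add: Compl_partition)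
    then show ?thesis
      by (simp add: obj_def smoothed_obj_def reduced_obj_def Z_def out distrib_left
          block_part_eq_if_coord_space[OF x_in_coord_space[OF N[OF k]]])
  qed
  from this[OF k] this[of N] show ?thesis by simp
qed

lemma recent_update:
  assumes "T \<le> k"
  obtains k' where "1 \<le> k'" "k - T < k'" "k' \<le> k" "i \<in> b k'" "x k $ i = x k' $ i"
proof -
  have "\<Union>S = UNIV" using blocks by (simp add: partition_on_def)
  then obtain s where s: "s \<in> S" "i \<in> s" by (metis UNIV_I UnionE)
  obtain j where j: "j \<in> {Suc (k - T)..<Suc (k - T) + T}" "b j = s"
    using cyclic[OF s(1), of "Suc (k - T)"] by auto
  let ?A = "{j. j \<le> k \<and> i \<in> b j \<and> 1 \<le> j}"
  have fin: "finite ?A" by (rule finite_subset[of _ "{..k}"]) auto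
  have jA: "j \<in> ?A" using j s assms by auto
  then have M: "Max ?A \<in> ?A" using fin by (intro Max_in) auto
  have "j \<le> Max ?A" using fin jA by (rule Max_ge)
  moreover have "x k $ i = x (Max ?A) $ i"
  proof (rule coordinate_const)
    show "Max ?A \<le> k" using M by blast
    fix n assume n: "Max ?A < n" "n \<le> k"
    show "i \<notin> b n"
    proof
      assume "i \<in> b n"
      then have "n \<in> ?A" using n by auto
      then have "n \<le> Max ?A" using fin by (intro Max_ge)
      then show False using n(1) by simp
    qed
  qed
  ultimately show thesis using that[of "Max ?A"] M j by auto
qed

text \<open>
  Up to a constant factor this bounds the path travelled during a window, whereas it is the square
  that the decrease of the objective controls.
\<close>

definition a :: "nat \<Rightarrow> real" where "a m = sqrt (window_energy m)"

lemma a_nonneg: "0 \<le> a m"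
  by (simp add: a_def window_energy_nonneg)

lemma a_power2: "(a m)\<^sup>2 = window_energy m"
  by (simp add: a_def window_energy_nonneg)

lemma a_tendsto_0: "a \<longlonglongrightarrow> 0"
  unfolding a_def using tendsto_real_sqrt[OF window_energy_tendsto_0] by simp

lemma norm_step_le_a: "k \<in> window m \<Longrightarrow> norm (step k) \<le> a m / sqrt l"
  using norm_step_le_window[of k m] by (simp add: a_def real_sqrt_divide)

lemma norm_diff_le_a:
  assumes "j \<le> k" "{j<..k} \<subseteq> window m"
  shows "norm (x k - x j) \<le> real T * (a m / sqrt l)"
proof -
  have "norm (x k - x j) \<le> real (k - j) * (a m / sqrt l)"
    using assms
  proof (induction k rule: dec_induct)
    case (step k)
    have "x (Suc k) - x j = step (Suc k) + (x k - x j)" by (simp add: step_def)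
    then have "norm (x (Suc k) - x j) \<le> norm (step (Suc k)) + norm (x k - x j)"
      by (metis norm_triangle_ineq)
    also have "\<dots> \<le> a m / sqrt l + real (k - j) * (a m / sqrt l)"
      using step by (intro add_mono norm_step_le_a step.IH) auto
    also have "\<dots> = (1 + real (k - j)) * (a m / sqrt l)" by (simp only: distrib_right mult_1)
    also have "1 + real (k - j) = real (Suc k - j)"
      using step.hyps by (simp add: Suc_diff_le)
    finally show ?case .
  qed simp
  moreover have "k - j \<le> T"
    using card_mono[OF _ assms(2)] by (simp add: window_def)
  ultimately show ?thesis
    using a_nonneg[of m] l_pos
    by (elim order_trans) (intro mult_right_mono, auto)
qed




text \<open>
  At the end of a window the optimality condition of the most recent update of a coordinate says
  that the corresponding partial derivative of the reduced function vanishes up to three errors: the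
  gradient is taken at an older, extrapolated point, there is a proximal term, and the weight belongs
  to an older point and older smoothing parameters. All of these are controlled by the increments of
  the last two windows and by the smoothing parameters, which also bound the remaining derivatives.
\<close>

lemma reduced_gradient_bound:
  assumes rho: "0 < \<rho>" and LG: "0 \<le> LG"
    and local_lip: "\<And>y z i. y \<in> ball xs (4 * \<rho>) \<Longrightarrow> z \<in> ball xs (4 * \<rho>) \<Longrightarrow>
      \<bar>gradf y $ i - gradf z $ i\<bar> \<le> LG * norm (y - z)"
  obtains M D where "0 < D" "\<And>m. M \<le> m \<Longrightarrow> x (m * T) \<in> ball xs \<rho> \<Longrightarrow>
    \<exists>v \<in> limiting_subdiff (coord_space I \<times> coord_space I) (\<lambda>z. ereal (reduced z)) (Z (m * T)).
      norm v \<le> D * (a m + a (m - 1) + rate ^ m)"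
proof -
  obtain N c E where c: "0 < c" and E: "0 \<le> E"
    and supp: "\<And>k. N \<le> k \<Longrightarrow> supp_idx (x k) = I"
    and low: "\<And>k i. N \<le> k \<Longrightarrow> i \<in> I \<Longrightarrow> c \<le> \<bar>x k $ i\<bar> + (eps k $ i)\<^sup>2"
    and geo: "\<And>k i. N \<le> k \<Longrightarrow> i \<in> I \<Longrightarrow> eps k $ i \<le> E * sqrt \<mu> ^ k"
    using final_support_behaviour by metis
  define \<sigma> where "\<sigma> m = (real T + 1) / sqrt l * (a m + a (m - 1))" for m
  have "(\<lambda>m. (real T + 1) / sqrt l * (a (Suc m) + a m)) \<longlonglongrightarrow> (real T + 1) / sqrt l * (0 + 0)"
    by (intro tendsto_intros a_tendsto_0 LIMSEQ_Suc[OF a_tendsto_0])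
  then have "(\<lambda>m. \<sigma> (Suc m)) \<longlonglongrightarrow> 0" by (simp add: \<sigma>_def)
  then have "\<sigma> \<longlonglongrightarrow> 0" by (rule LIMSEQ_imp_Suc)
  then have "eventually (\<lambda>m. \<sigma> m < \<rho>) sequentially" using rho by (intro order_tendstoD(2)) auto
  then obtain M1 where M1: "\<And>m. M1 \<le> m \<Longrightarrow> \<sigma> m < \<rho>" by (auto simp: eventually_sequentially)
  define M where "M = M1 + N + 2"
  define \<kappa> where "\<kappa> = lam * (p * ((1 - p) * c powr (p - 2)))"
  have \<kappa>: "0 \<le> \<kappa>" using lam p by (simp add: \<kappa>_def)
  define E' where "E' = E / rate"
  have E': "0 \<le> E'" using E rate by (simp add: E'_def)
  have L: "0 < L" using Lip_range[of 1] l_pos by simp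
  define D1 where "D1 = (LG + 2 * L + \<kappa>) * ((real T + 1) / sqrt l)"
  define D2 where "D2 = \<kappa> * E'\<^sup>2"
  define D3 where "D3 = lam * (p * c powr (p - 1) * (2 * E'))"
  define D0 where "D0 = D1 + D2 + D3 + 1"
  have D1: "0 \<le> D1" using LG L \<kappa> l_pos by (simp add: D1_def)
  have D2: "0 \<le> D2" using \<kappa> by (simp add: D2_def)
  have D3: "0 \<le> D3" using lam p E' by (simp add: D3_def)
  define D where "D = 2 * real CARD('n) * D0"
  have D: "0 < D" using D1 D2 D3 by (simp add: D_def D0_def)
  have "\<exists>v \<in> limiting_subdiff (coord_space I \<times> coord_space I) (\<lambda>z. ereal (reduced z)) (Z (m * T)).
      norm v \<le> D * (a m + a (m - 1) + rate ^ m)" if m: "M \<le> m" and ball: "x (m * T) \<in> ball xs \<rho>" for m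
  proof -
    define k where "k = m * T"
    define s where "s = a m + a (m - 1) + rate ^ m"
    define n where "n = m - 2"
    have n: "m = Suc (Suc n)" "M1 \<le> m" "N \<le> Suc n" using m by (auto simp: M_def n_def)
    have kT: "k = T + (T + n * T)" by (simp add: k_def n)
    have NT: "N \<le> T + n * T"
      using n(3) T_pos mult_le_mono[of "Suc n" "Suc n" 1 T] by simp
    have rm: "0 \<le> rate ^ m" "rate ^ m \<le> 1" using rate by (auto intro: power_le_one)
    have "N \<le> k" using NT kT by simp
    note supp_k = supp[OF this]
    have x_k: "x k \<in> coord_space I" using supp_k by (rule x_in_coord_space)
    have nz_k: "x k $ i \<noteq> 0" if "i \<in> I" for i using supp_k that by (auto simp: supp_idx_def)
    let ?v = "reduced_grad gradf lam p I (x k) (block_part I (eps k))"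
    have v: "?v \<in> limiting_subdiff (coord_space I \<times> coord_space I) (\<lambda>z. ereal (reduced z)) (Z k)"
      unfolding Z_def using x_k nz_k
      by (intro gradient_in_limiting_subdiff reduced_obj_has_derivative f_grad reduced_grad_in_subspace) auto
    have comps: "\<bar>fst ?v $ i\<bar> \<le> D0 * s \<and> \<bar>snd ?v $ i\<bar> \<le> D0 * s" for i
    proof (cases "i \<in> I")
      case True
      obtain k' where k': "1 \<le> k'" "k - T < k'" "k' \<le> k" "i \<in> b k'" "x k $ i = x k' $ i"
        using recent_update[of k i] kT by auto
      have k'n: "T + n * T < k'" "k' \<le> T + (T + n * T)" using k' kT by auto
      let ?e = "extrap_point k'" and ?j = "last_update b k'"
      have win: "{k' - 1<..k} \<subseteq> window m" "{k' - 1<..k'} \<subseteq> window m"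
        using k' k'n kT by (auto simp: window_Suc n(1))
      have "?j \<in> window m \<or> ?j \<in> window (m - 1)"
        using last_update_recent[of k'] last_update_less[OF k'(1), of b] k'n
        by (auto simp: n window_Suc)
      then have st: "norm (step ?j) \<le> (a m + a (m - 1)) / sqrt l"
        using norm_step_le_a[of ?j m] norm_step_le_a[of ?j "m - 1"] a_nonneg[of m] a_nonneg[of "m - 1"] l_pos
        by (auto simp: add_divide_distrib intro: order_trans)
      have near: "norm (x j - x (k' - 1)) \<le> real T * ((a m + a (m - 1)) / sqrt l)"
        if "j = k \<or> j = k'" for j
      proof -
        have "norm (x j - x (k' - 1)) \<le> real T * (a m / sqrt l)"
          using that win k' by (intro norm_diff_le_a) auto
        also have "\<dots> \<le> real T * ((a m + a (m - 1)) / sqrt l)"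
          using a_nonneg[of "m - 1"] l_pos by (intro mult_left_mono divide_right_mono) auto
        finally show ?thesis .
      qed
      have sig: "real T * ((a m + a (m - 1)) / sqrt l) + (a m + a (m - 1)) / sqrt l = \<sigma> m"
        by (simp add: \<sigma>_def algebra_simps add_divide_distrib)
      have beta_st: "norm (\<beta> k' *\<^sub>R step ?j) \<le> (a m + a (m - 1)) / sqrt l"
      proof -
        have "\<beta> k' * norm (step ?j) \<le> 1 * norm (step ?j)"
          using beta_range[OF k'(1)] by (intro mult_right_mono) auto
        then show ?thesis using st beta_range[OF k'(1)] by simp
      qed
      have ex: "norm (x j - ?e) \<le> \<sigma> m" if "j = k \<or> j = k'" for j
      proof -
        have "x j - ?e = (x j - x (k' - 1)) - \<beta> k' *\<^sub>R step ?j" by (simp add: extrap_point_def)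
        then have "norm (x j - ?e) \<le> norm (x j - x (k' - 1)) + norm (\<beta> k' *\<^sub>R step ?j)"
          by (metis norm_triangle_ineq4)
        then show ?thesis using near[OF that] beta_st sig by linarith
      qed
      have g: "\<bar>gradf (x k) $ i - gradf ?e $ i\<bar> \<le> LG * \<sigma> m"
      proof -
        have "dist xs ?e \<le> dist xs (x k) + dist (x k) ?e" by (rule dist_triangle)
        then have "dist xs ?e < 4 * \<rho>"
          using ball ex[of k] M1[OF n(2)] rho by (simp add: dist_norm k_def)
        moreover have "dist xs (x k) < 4 * \<rho>" using ball rho by (simp add: k_def)
        ultimately have "\<bar>gradf (x k) $ i - gradf ?e $ i\<bar> \<le> LG * norm (x k - ?e)"
          by (intro local_lip) auto
        also have "\<dots> \<le> LG * \<sigma> m" using ex[of k] LG by (intro mult_left_mono) auto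
        finally show ?thesis .
      qed
      have pr: "\<bar>2 * Lip k' * (x k' $ i - ?e $ i)\<bar> \<le> 2 * L * \<sigma> m"
      proof -
        have "\<bar>x k' $ i - ?e $ i\<bar> \<le> \<sigma> m"
          using component_le_norm_cart[of "x k' - ?e" i] ex[of k'] by simp
        then have "2 * Lip k' * \<bar>x k' $ i - ?e $ i\<bar> \<le> 2 * L * \<sigma> m"
          using Lip_range[OF k'(1)] l_pos by (intro mult_mono) auto
        then show ?thesis using Lip_pos[OF k'(1)] by (simp add: abs_mult)
      qed
      let ?t1 = "\<bar>x k $ i\<bar> + (eps k $ i)\<^sup>2" and ?t0 = "\<bar>x (k' - 1) $ i\<bar> + (eps (k' - 1) $ i)\<^sup>2"
      have "N \<le> k' - 1" using NT k'n by simp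
      have t: "c \<le> ?t1" "c \<le> ?t0" using low True \<open>N \<le> k\<close> \<open>N \<le> k' - 1\<close> by auto
      have e1: "eps (k' - 1) $ i \<le> E' * rate ^ m"
      proof -
        have "eps (k' - 1) $ i \<le> E * sqrt \<mu> ^ (k' - 1)" using geo True \<open>N \<le> k' - 1\<close> by simp
        also have "\<dots> \<le> E * sqrt \<mu> ^ (Suc n * T)"
          using E sqrt_mu k'n by (intro mult_left_mono power_decreasing) auto
        also have "sqrt \<mu> ^ (Suc n * T) = rate ^ Suc n"
          by (simp only: rate_def power_mult[symmetric] mult.commute)
        also have "E * rate ^ Suc n = E' * rate ^ m" using rate by (simp add: E'_def n)
        finally show ?thesis .
      qed
      have ek: "0 < eps k $ i" "eps k $ i \<le> eps (k' - 1) $ i"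
        using eps_pos eps_antimono[of "k' - 1" k i] k' by auto
      have e2: "(eps (k' - 1) $ i)\<^sup>2 \<le> E'\<^sup>2 * rate ^ m"
      proof -
        have "(eps (k' - 1) $ i)\<^sup>2 \<le> (E' * rate ^ m)\<^sup>2"
          using e1 eps_pos[of "k' - 1" i] by (intro power_mono) auto
        also have "\<dots> = E'\<^sup>2 * (rate ^ m * rate ^ m)" by (simp add: power2_eq_square algebra_simps)
        also have "\<dots> \<le> E'\<^sup>2 * (1 * rate ^ m)" using rm by (intro mult_left_mono mult_right_mono) auto
        finally show ?thesis by simp
      qed
      have w: "lam * (p * \<bar>?t1 powr (p - 1) - ?t0 powr (p - 1)\<bar>) \<le> \<kappa> * \<sigma> m + D2 * rate ^ m"
      proof -
        have "\<bar>x k $ i - x (k' - 1) $ i\<bar> \<le> norm (x k - x (k' - 1))"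
          using component_le_norm_cart[of "x k - x (k' - 1)" i] by simp
        also have "\<dots> \<le> \<sigma> m"
        proof -
          have "0 \<le> (a m + a (m - 1)) / sqrt l"
            using a_nonneg[of m] a_nonneg[of "m - 1"] l_pos by simp
          then show ?thesis using near[of k] sig by simp
        qed
        finally have "\<bar>\<bar>x k $ i\<bar> - \<bar>x (k' - 1) $ i\<bar>\<bar> \<le> \<sigma> m"
          using abs_triangle_ineq3[of "x k $ i" "x (k' - 1) $ i"] by linarith
        moreover have "0 \<le> (eps k $ i)\<^sup>2" "(eps k $ i)\<^sup>2 \<le> (eps (k' - 1) $ i)\<^sup>2"
          using ek by (auto intro: power_mono)
        ultimately have "\<bar>?t1 - ?t0\<bar> \<le> \<sigma> m + E'\<^sup>2 * rate ^ m"
          using e2 by (intro abs_leI) linarith+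
        then have mono: "(1 - p) * c powr (p - 2) * \<bar>?t1 - ?t0\<bar>
            \<le> (1 - p) * c powr (p - 2) * (\<sigma> m + E'\<^sup>2 * rate ^ m)"
          using p by (intro mult_left_mono) auto
        have lip: "\<bar>?t1 powr (p - 1) - ?t0 powr (p - 1)\<bar> \<le> \<bar>p - 1\<bar> * c powr (p - 1 - 1) * \<bar>?t1 - ?t0\<bar>"
          using c t p by (intro powr_lipschitz_away_from_0) auto
        have eqs: "\<bar>p - 1\<bar> = 1 - p" "p - 1 - 1 = p - 2" using p by simp_all
        have "\<bar>?t1 powr (p - 1) - ?t0 powr (p - 1)\<bar>
            \<le> (1 - p) * c powr (p - 2) * (\<sigma> m + E'\<^sup>2 * rate ^ m)"
          by (rule order_trans[OF lip[unfolded eqs] mono])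
        then have "lam * (p * \<bar>?t1 powr (p - 1) - ?t0 powr (p - 1)\<bar>)
            \<le> lam * (p * ((1 - p) * c powr (p - 2) * (\<sigma> m + E'\<^sup>2 * rate ^ m)))"
          using lam p by (intro mult_left_mono) auto
        also have "\<dots> = \<kappa> * \<sigma> m + D2 * rate ^ m"
          by (simp add: \<kappa>_def D2_def algebra_simps)
        finally show ?thesis .
      qed
      have opt: "gradf ?e $ i + 2 * Lip k' * (x k' $ i - ?e $ i)
          + lam * (p * ?t0 powr (p - 1) * sgn (x k $ i)) = 0"
        using optimality[OF k'(1,4)] nz_k[OF True] k'(5) by (simp add: lp_weight_def)
      have "fst ?v $ i = gradf (x k) $ i + lam * (p * ?t1 powr (p - 1) * sgn (x k $ i))"
        using True by (simp add: reduced_grad_def)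
      also have "\<dots> = (gradf (x k) $ i - gradf ?e $ i) - 2 * Lip k' * (x k' $ i - ?e $ i)
          + lam * (p * (?t1 powr (p - 1) - ?t0 powr (p - 1))) * sgn (x k $ i)"
        using opt by (simp add: algebra_simps)
      finally have "\<bar>fst ?v $ i\<bar> \<le> \<bar>gradf (x k) $ i - gradf ?e $ i\<bar> + \<bar>2 * Lip k' * (x k' $ i - ?e $ i)\<bar>
          + \<bar>lam * (p * (?t1 powr (p - 1) - ?t0 powr (p - 1))) * sgn (x k $ i)\<bar>"
        by linarith
      also have "\<bar>lam * (p * (?t1 powr (p - 1) - ?t0 powr (p - 1))) * sgn (x k $ i)\<bar>
          = lam * (p * \<bar>?t1 powr (p - 1) - ?t0 powr (p - 1)\<bar>)"
        using lam p nz_k[OF True] by (simp add: abs_mult abs_sgn_eq)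
      finally have "\<bar>fst ?v $ i\<bar> \<le> LG * \<sigma> m + 2 * L * \<sigma> m + (\<kappa> * \<sigma> m + D2 * rate ^ m)"
        using g pr w by linarith
      also have "\<dots> = D1 * (a m + a (m - 1)) + D2 * rate ^ m"
        by (simp only: D1_def \<sigma>_def distrib_right mult.assoc add.assoc)
      also have "\<dots> \<le> D0 * (a m + a (m - 1)) + D0 * rate ^ m"
        using D1 D2 D3 a_nonneg[of m] a_nonneg[of "m - 1"] rm
        by (intro add_mono mult_right_mono) (auto simp: D0_def)
      finally have v1: "\<bar>fst ?v $ i\<bar> \<le> D0 * s" by (simp add: s_def algebra_simps)
      have "?t1 powr (p - 1) \<le> c powr (p - 1)" using c t p by (intro powr_mono2') auto
      then have "lam * (p * ?t1 powr (p - 1) * (2 * eps k $ i)) \<le> lam * (p * c powr (p - 1) * (2 * (E' * rate ^ m)))"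
        using lam p ek e1 by (intro mult_left_mono mult_mono) auto
      also have "\<dots> = D3 * rate ^ m" by (simp add: D3_def)
      also have "\<dots> \<le> D0 * s"
        using D1 D2 D3 a_nonneg[of m] a_nonneg[of "m - 1"] rm
        by (intro mult_mono) (auto simp: D0_def s_def)
      finally have "\<bar>snd ?v $ i\<bar> \<le> D0 * s"
        using True lam p ek by (simp add: reduced_grad_def abs_mult)
      with v1 show ?thesis by simp
    next
      case False
      have "0 \<le> D0 * s"
        using D1 D2 D3 a_nonneg[of m] a_nonneg[of "m - 1"] rm by (simp add: D0_def s_def)
      then show ?thesis using False by (simp add: reduced_grad_def)
    qed
    have "norm ?v \<le> norm (fst ?v) + norm (snd ?v)"
      using norm_Pair_le[of "fst ?v" "snd ?v"] by simp
    also have "\<dots> \<le> real CARD('n) * (D0 * s) + real CARD('n) * (D0 * s)"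
      using comps by (intro add_mono norm_le_card_mult_bound) auto
    also have "\<dots> = D * (a m + a (m - 1) + rate ^ m)" by (simp add: D_def s_def mult_ac)
    finally have "norm ?v \<le> D * (a m + a (m - 1) + rate ^ m)" .
    with v show ?thesis unfolding k_def by blast
  qed
  with D show thesis by (rule that)
qed




section \<open>Convergence\<close>

lemma frequently_nonzero_on_support:
  assumes "i \<in> I"
  shows "frequently (\<lambda>k. x k $ i \<noteq> 0) sequentially"
proof -
  have "eventually (\<lambda>k. x k $ i \<noteq> 0) sequentially"
    using eventually_supp_idx by eventually_elim (use assms in \<open>auto simp: supp_idx_def\<close>)
  then show ?thesis by (rule eventually_frequently[rotated]) simp
qed

lemma eps_on_support_tendsto_0: "(\<lambda>k. block_part I (eps k)) \<longlonglongrightarrow> 0"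
proof (rule vec_tendstoI)
  fix i
  show "(\<lambda>k. block_part I (eps k) $ i) \<longlonglongrightarrow> 0 $ i"
    using eps_tendsto_0[OF frequently_nonzero_on_support[of i]] by (cases "i \<in> I") auto
qed

lemma limit_point_in_coord_space:
  assumes r: "strict_mono r" "(x \<circ> r) \<longlonglongrightarrow> xs"
  shows "xs \<in> coord_space I"
  unfolding coord_space_def
proof (intro CollectI allI impI)
  fix i assume i: "i \<notin> I"
  have "eventually (\<lambda>k. supp_idx (x (r k)) = I) sequentially"
    by (rule eventually_compose_filterlim[OF eventually_supp_idx filterlim_subseq[OF r(1)]])
  then have ev: "eventually (\<lambda>k. (x \<circ> r) k $ i = 0) sequentially"
    by eventually_elim (use i in \<open>auto simp: supp_idx_def\<close>)
  have "(\<lambda>k. (x \<circ> r) k $ i) \<longlonglongrightarrow> xs $ i" by (intro tendsto_vec_nth r(2))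
  from Lim_transform_eventually[OF this ev] show "xs $ i = 0" by (simp add: LIMSEQ_const_iff)
qed

text \<open>
  The reduced function differs from the objective along the iterates by a constant, hence it
  decreases along them to its value at the limit point.
\<close>

lemma reduced_gap:
  assumes r: "strict_mono r" "(x \<circ> r) \<longlonglongrightarrow> xs"
  obtains N where
    "\<And>k. N \<le> k \<Longrightarrow> supp_idx (x k) = I"
    "\<And>j k. N \<le> j \<Longrightarrow> N \<le> k \<Longrightarrow> reduced (Z j) - reduced (Z k) = obj j - obj k"
    "\<And>k. N \<le> k \<Longrightarrow> reduced (xs, 0) \<le> reduced (Z k)"
    "(\<lambda>k. reduced (Z k)) \<longlonglongrightarrow> reduced (xs, 0)"
proof -
  obtain N where N: "\<And>k. N \<le> k \<Longrightarrow> supp_idx (x k) = I"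
    using eventually_supp_idx by (auto simp: eventually_sequentially)
  have diff: "reduced (Z j) - reduced (Z k) = obj j - obj k" if "N \<le> j" "N \<le> k" for j k
    using obj_diff_eq_reduced_diff[OF N that(1)] obj_diff_eq_reduced_diff[OF N that(2)] by simp
  have anti: "reduced (Z k) \<le> reduced (Z j)" if "N \<le> j" "j \<le> k" for j k
    using diff[of j k] obj_antimono[of j k] that by simp
  have "(\<lambda>k. Z (r k)) \<longlonglongrightarrow> (xs, 0)"
    unfolding Z_def
    using r(2) filterlim_compose[OF eps_on_support_tendsto_0 filterlim_subseq[OF r(1)]]
    by (intro tendsto_Pair) (auto simp: o_def)
  then have lim: "(\<lambda>k. reduced (Z (r k))) \<longlonglongrightarrow> reduced (xs, 0)"
    using isCont_tendsto_compose[OF continuous_reduced_obj[OF continuous_on_f p(1)]] by blast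
  have low: "reduced (xs, 0) \<le> reduced (Z k)" if k: "N \<le> k" for k
  proof (rule tendsto_upperbound[OF lim])
    show "eventually (\<lambda>j. reduced (Z (r j)) \<le> reduced (Z k)) sequentially"
      using eventually_ge_at_top[of k]
    proof eventually_elim
      case (elim j)
      then have "k \<le> r j" using seq_suble[OF r(1), of j] by simp
      then show ?case using anti k by simp
    qed
  qed simp
  have "(\<lambda>k. reduced (Z k)) \<longlonglongrightarrow> reduced (xs, 0)"
  proof (rule LIMSEQ_I)
    fix e :: real assume "0 < e"
    then have "eventually (\<lambda>j. reduced (Z (r j)) < reduced (xs, 0) + e) sequentially"
      by (intro order_tendstoD(2)[OF lim]) auto
    moreover have "eventually (\<lambda>j. N \<le> r j) sequentially"
      using filterlim_subseq[OF r(1)] by (simp add: filterlim_at_top)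
    ultimately have "eventually (\<lambda>j. N \<le> r j \<and> reduced (Z (r j)) < reduced (xs, 0) + e) sequentially"
      by eventually_elim simp
    then obtain j where j: "N \<le> r j" "reduced (Z (r j)) < reduced (xs, 0) + e"
      by (auto dest: eventually_happens)
    have "norm (reduced (Z k) - reduced (xs, 0)) < e" if "r j \<le> k" for k
      using anti[OF j(1) that] low[of k] j that by simp
    then show "\<exists>no. \<forall>k\<ge>no. norm (reduced (Z k) - reduced (xs, 0)) < e" by blast
  qed
  with N diff low show thesis by (rule that)
qed

lemma filterlim_div_T: "filterlim (\<lambda>k. k div T) at_top sequentially"
  unfolding filterlim_at_top
proof
  fix M
  have "M \<le> k div T" if "M * T \<le> k" for k
    using div_le_mono[OF that, of T] T_pos by simp
  then show "eventually (\<lambda>k. M \<le> k div T) sequentially"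
    unfolding eventually_sequentially by blast
qed

lemma iterate_minus_window_start_tendsto_0: "(\<lambda>k. x k - x (k div T * T)) \<longlonglongrightarrow> 0"
proof (rule Lim_null_comparison)
  have "norm (x k - x (k div T * T)) \<le> real T * (a (Suc (k div T)) / sqrt l)" for k
  proof -
    have "k div T * T \<le> k" by (rule div_times_less_eq_dividend)
    moreover have "k < k div T * T + T"
      using T_pos by (metis add.commute dividend_less_div_times mult.commute)
    ultimately show ?thesis by (intro norm_diff_le_a) (auto simp: window_Suc)
  qed
  then show "eventually (\<lambda>k. norm (x k - x (k div T * T)) \<le> real T * (a (Suc (k div T)) / sqrt l))
      sequentially" by simp
  have "(\<lambda>k. real T * (a (Suc (k div T)) / sqrt l)) \<longlonglongrightarrow> real T * (0 / sqrt l)"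
    by (intro tendsto_intros filterlim_compose[OF LIMSEQ_Suc[OF a_tendsto_0] filterlim_div_T])
      (use l_pos in auto)
  then show "(\<lambda>k. real T * (a (Suc (k div T)) / sqrt l)) \<longlonglongrightarrow> 0" by simp
qed

text \<open>
  Both sides of the conclusion are nonnegative, and the square of the right-hand side contains
  \<open>(s / 8 + 2 * D * \<Delta>)\<^sup>2\<close>, which dominates the product of its summands four times. The factor 1/8
  is small enough for a telescoping sum when \<open>s\<close> is itself a sum of such lengths.
\<close>

lemma window_length_recursion:
  fixes A B C D s \<Delta> :: real
  assumes "A\<^sup>2 \<le> 1/4 * B\<^sup>2 + \<Delta> * (D * s)" "0 \<le> A" "0 \<le> B" "0 \<le> s" "0 < D" "0 \<le> \<Delta>"
  shows "A \<le> B / 2 + s / 8 + 2 * D * \<Delta>"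
proof (rule power2_le_imp_le)
  have "0 \<le> (s / 8 - 2 * D * \<Delta>)\<^sup>2" "0 \<le> B * (s / 8 + 2 * D * \<Delta>)"
    using assms by auto
  then have "1/4 * B\<^sup>2 + \<Delta> * (D * s) \<le> (B / 2 + s / 8 + 2 * D * \<Delta>)\<^sup>2"
    by (simp add: power2_eq_square algebra_simps)
  then show "A\<^sup>2 \<le> (B / 2 + s / 8 + 2 * D * \<Delta>)\<^sup>2" using assms(1) by linarith
qed (use assms in auto)

text \<open>
  By concavity of \<open>\<phi>\<close> and the Kurdyka-Lojasiewicz inequality, the objective decrease over a window is
  at most the decrease of \<open>\<phi>\<close> at the objective gap, times the size of the gradient, which in turn is
  controlled by the lengths of the two preceding windows. Splitting this product as in the previous
  lemma bounds \<open>a (Suc m)\<close> by \<open>5/8 * a m + 1/8 * a (m - 1)\<close> plus telescoping and geometric terms. As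
  5/8 + 1/8 is less than 1, a multiple of \<open>a (Suc m)\<close> is at most the decrease of a potential \<open>Q\<close> that
  tends to 0, and the trapping principle applies to the starting points of the windows.
\<close>

lemma iterates_converge:
  assumes lim: "seq_limit_point x xs"
    and KL: "KL_property (coord_space I \<times> coord_space I) (\<lambda>z. ereal (reduced z)) (block_part I xs, 0)"
    and rho: "0 < \<rho>" and LG: "0 \<le> LG"
    and local_lip: "\<And>y z i. y \<in> ball xs (4 * \<rho>) \<Longrightarrow> z \<in> ball xs (4 * \<rho>) \<Longrightarrow>
      \<bar>gradf y $ i - gradf z $ i\<bar> \<le> LG * norm (y - z)"
  shows "x \<longlonglongrightarrow> xs"
proof -
  obtain r where r: "strict_mono r" "(x \<circ> r) \<longlonglongrightarrow> xs" using lim by (auto simp: seq_limit_point_def)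
  have xsI: "block_part I xs = xs"
    by (rule block_part_eq_if_coord_space[OF limit_point_in_coord_space[OF r]])
  let ?V = "coord_space I \<times> coord_space I"
  let ?J = "\<lambda>z. ereal (reduced z)"
  obtain U \<xi> \<phi> \<phi>' where U: "open U" "(xs, 0) \<in> U" and \<xi>: "0 < \<xi>"
    and conc: "concave_on {t. 0 \<le> t \<and> ereal t < \<xi>} \<phi>"
    and nonneg: "\<And>t. 0 \<le> t \<and> ereal t < \<xi> \<Longrightarrow> 0 \<le> \<phi> t"
    and cont: "continuous (at 0 within {t. 0 \<le> t \<and> ereal t < \<xi>}) \<phi>"
    and \<phi>0: "\<phi> 0 = 0"
    and der: "\<And>t. 0 < t \<and> ereal t < \<xi> \<Longrightarrow> (\<phi> has_real_derivative \<phi>' t) (at t)"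
    and pos: "\<And>t. 0 < t \<and> ereal t < \<xi> \<Longrightarrow> 0 < \<phi>' t"
    and KLineq: "\<And>z. z \<in> U \<inter> ?V \<Longrightarrow> ?J (xs, 0) < ?J z \<Longrightarrow> ?J z < ?J (xs, 0) + \<xi> \<Longrightarrow>
      1 \<le> ereal (\<phi>' (real_of_ereal (?J z - ?J (xs, 0)))) * dist_zero (limiting_subdiff ?V ?J z)"
    using KL unfolding KL_property_def xsI by blast
  let ?A = "{t. 0 \<le> t \<and> ereal t < \<xi>}"
  obtain \<xi>0 where \<xi>0: "0 < \<xi>0" "ereal \<xi>0 < \<xi>"
    using ereal_dense2[OF \<xi>] by (auto simp: zero_ereal_def)
  have in_A: "t \<in> ?A" if "0 \<le> t" "t < \<xi>0" for t
    using that \<xi>0(2) by (auto intro: less_trans[of _ "ereal \<xi>0"])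
  obtain U1 U2 where U12: "open U1" "open U2" "(xs, 0) \<in> U1 \<times> U2" "U1 \<times> U2 \<subseteq> U"
    using open_prod_elim[OF U] by metis
  obtain \<rho>1 where \<rho>1: "0 < \<rho>1" "ball xs \<rho>1 \<subseteq> U1"
    using U12 open_contains_ball by (metis mem_Sigma_iff)
  define \<rho>' where "\<rho>' = min \<rho> \<rho>1"
  have \<rho>': "0 < \<rho>'" using rho \<rho>1 by (simp add: \<rho>'_def)
  define gap where "gap k = reduced (Z k) - reduced (xs, 0)" for k
  obtain N where N: "\<And>k. N \<le> k \<Longrightarrow> supp_idx (x k) = I"
    "\<And>j k. N \<le> j \<Longrightarrow> N \<le> k \<Longrightarrow> reduced (Z j) - reduced (Z k) = obj j - obj k"
    "\<And>k. N \<le> k \<Longrightarrow> reduced (xs, 0) \<le> reduced (Z k)"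
    "(\<lambda>k. reduced (Z k)) \<longlonglongrightarrow> reduced (xs, 0)"
    using reduced_gap[OF r] by blast
  have gap0: "gap \<longlonglongrightarrow> 0"
    using N(4) unfolding gap_def by (simp add: LIM_zero)
  obtain M D where D: "0 < D" and grad: "\<And>m. M \<le> m \<Longrightarrow> x (m * T) \<in> ball xs \<rho> \<Longrightarrow>
      \<exists>v \<in> limiting_subdiff ?V ?J (Z (m * T)). norm v \<le> D * (a m + a (m - 1) + rate ^ m)"
    using reduced_gradient_bound[OF rho LG local_lip] by blast
  have "eventually (\<lambda>k. gap k < \<xi>0) sequentially" using \<xi>0(1) gap0 by (intro order_tendstoD(2))
  moreover have "eventually (\<lambda>k. block_part I (eps k) \<in> U2) sequentially"
    using eps_on_support_tendsto_0 U12 by (intro topological_tendstoD) auto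
  ultimately have "eventually (\<lambda>k. gap k < \<xi>0 \<and> block_part I (eps k) \<in> U2) sequentially"
    by eventually_elim simp
  then obtain N' where N': "\<And>k. N' \<le> k \<Longrightarrow> gap k < \<xi>0" "\<And>k. N' \<le> k \<Longrightarrow> block_part I (eps k) \<in> U2"
    by (auto simp: eventually_sequentially)
  define M' where "M' = M + N + N' + 1"
  have mT: "m \<le> m * T" for m using T_pos by simp
  have big: "M \<le> m" "N \<le> m * T" "N' \<le> m * T" "1 \<le> m" if "M' \<le> m" for m
    using that order_trans[OF _ mT[of m], of N] order_trans[OF _ mT[of m], of N'] by (auto simp: M'_def)
  define g where "g m = gap (m * T)" for m
  have gA: "g m \<in> ?A" if "M' \<le> m" for m
    using in_A[of "g m"] N(3)[OF big(2)[OF that]] N'(1)[OF big(3)[OF that]]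
    by (simp add: g_def gap_def)
  have gdiff: "g m - g (Suc m) = wobj m - wobj (Suc m)" if "M' \<le> m" for m
    using N(2)[of "m * T" "Suc m * T"] big(2)[of m] big(2)[of "Suc m"] that
    by (simp add: g_def gap_def wobj_def)
  define \<Phi> where "\<Phi> m = \<phi> (g m)" for m
  define \<tau> where "\<tau> = 1 / (2 * (1 - rate))"
  have \<tau>: "0 < \<tau>" "\<tau> = 1/2 + \<tau> * rate" using rate by (auto simp: \<tau>_def field_simps)
  \<comment> \<open>The coefficients 3 and 1/2 are chosen such that four times the recursion for \<open>a (Suc m)\<close> reads
    \<open>a (Suc m) \<le> Q m - Q (Suc m)\<close>, up to the leading factor; \<open>\<tau> * rate ^ m\<close> is half the tail of the
    geometric series.\<close>
  define Q where "Q m = real T / sqrt l * (3 * a m + a (m - 1) / 2 + 8 * D * \<Phi> m + \<tau> * rate ^ m)" for m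
  have KLstep: "(a (Suc m))\<^sup>2 \<le> 1/4 * (a m)\<^sup>2 + (\<Phi> m - \<Phi> (Suc m)) * (D * (a m + a (m - 1) + rate ^ m))
      \<and> 0 \<le> \<Phi> m - \<Phi> (Suc m)"
    if m: "M' \<le> m" and ball: "dist (x (m * T)) xs < \<rho>'" for m
  proof -
    let ?s = "a m + a (m - 1) + rate ^ m"
    have s: "0 \<le> ?s" using a_nonneg[of m] a_nonneg[of "m - 1"] rate by simp
    have dec: "(a (Suc m))\<^sup>2 \<le> 1/4 * (a m)\<^sup>2 + (g m - g (Suc m))"
      using window_decrease[OF big(4)[OF m]] gdiff[OF m] by (simp add: a_power2)
    have gmono: "g (Suc m) \<le> g m" using gdiff[OF m] wobj_antimono[of m "Suc m"] by simp
    have g0: "0 \<le> g (Suc m)" using gA[of "Suc m"] m by simp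
    show ?thesis
    proof (cases "g m = 0")
      \<comment> \<open>Here the inequality is not applicable, but the objective has become constant.\<close>
      case True
      then have "g (Suc m) = 0" using g0 gmono by simp
      then show ?thesis using True dec by (simp add: \<Phi>_def)
    next
      case False
      then have gm: "0 < g m" "ereal (g m) < \<xi>" using gA[OF m] by auto
      have "x (m * T) \<in> ball xs \<rho>" using ball by (simp add: \<rho>'_def dist_commute)
      then obtain v where v: "v \<in> limiting_subdiff ?V ?J (Z (m * T))" "norm v \<le> D * ?s"
        using grad big(1)[OF m] by blast
      have "Z (m * T) \<in> U \<inter> ?V"
      proof
        have "x (m * T) \<in> U1" using ball \<rho>1(2) by (auto simp: \<rho>'_def dist_commute)
        then show "Z (m * T) \<in> U" using U12(4) N'(2)[OF big(3)[OF m]] by (auto simp: Z_def)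
        show "Z (m * T) \<in> ?V"
          using x_in_coord_space[OF N(1)[OF big(2)[OF m]]] by (simp add: Z_def)
      qed
      moreover have "?J (xs, 0) < ?J (Z (m * T))" using gm(1) by (simp add: g_def gap_def)
      moreover have "?J (Z (m * T)) < ?J (xs, 0) + \<xi>"
        using gm(2) by (cases \<xi>) (auto simp: g_def gap_def)
      ultimately have "1 \<le> ereal (\<phi>' (real_of_ereal (?J (Z (m * T)) - ?J (xs, 0))))
          * dist_zero (limiting_subdiff ?V ?J (Z (m * T)))"
        by (rule KLineq)
      also have "real_of_ereal (?J (Z (m * T)) - ?J (xs, 0)) = g m" by (simp add: g_def gap_def)
      also have "ereal (\<phi>' (g m)) * dist_zero (limiting_subdiff ?V ?J (Z (m * T))) \<le> ereal (\<phi>' (g m)) * ereal (norm v)"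
        using pos[of "g m"] gm v(1) by (intro ereal_mult_left_mono) (auto simp: dist_zero_def intro!: INF_lower)
      finally have "1 \<le> \<phi>' (g m) * norm v" by (simp add: one_ereal_def)
      also have "\<dots> \<le> \<phi>' (g m) * (D * ?s)" using pos[of "g m"] gm v(2) by (intro mult_left_mono) auto
      finally have one: "1 \<le> \<phi>' (g m) * (D * ?s)" .
      have tangent: "\<phi> (g (Suc m)) \<le> \<phi> (g m) + \<phi>' (g m) * (g (Suc m) - g m)"
      proof (rule concave_on_le_tangent[OF conc])
        show "connected ?A" using conc by (intro convex_connected) (simp add: concave_on_iff)
        have "{0<..<\<xi>0} \<subseteq> ?A" using in_A by auto
        moreover have "g m \<in> {0<..<\<xi>0}" using gm(1) N'(1)[OF big(3)[OF m]] by (simp add: g_def)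
        ultimately show "g m \<in> interior ?A" by (meson interior_maximal open_greaterThanLessThan subsetD)
        show "g (Suc m) \<in> ?A" using gA[of "Suc m"] m by simp
      qed (use der gm in blast)
      have phi': "0 \<le> \<phi>' (g m) * (g m - g (Suc m))" using pos[of "g m"] gm gmono by simp
      have "g m - g (Suc m) = 1 * (g m - g (Suc m))" by simp
      also have "\<dots> \<le> (\<phi>' (g m) * (D * ?s)) * (g m - g (Suc m))"
        using one gmono by (intro mult_right_mono) auto
      also have "\<dots> = (\<phi>' (g m) * (g m - g (Suc m))) * (D * ?s)" by (simp add: algebra_simps)
      also have "\<dots> \<le> (\<Phi> m - \<Phi> (Suc m)) * (D * ?s)"
      proof (rule mult_right_mono)
        show "\<phi>' (g m) * (g m - g (Suc m)) \<le> \<Phi> m - \<Phi> (Suc m)"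
          using tangent by (simp add: \<Phi>_def algebra_simps)
      qed (use s D in simp)
      finally have "g m - g (Suc m) \<le> (\<Phi> m - \<Phi> (Suc m)) * (D * ?s)" .
      moreover have "0 \<le> \<Phi> m - \<Phi> (Suc m)" using tangent phi' by (simp add: \<Phi>_def algebra_simps)
      ultimately show ?thesis using dec by linarith
    qed
  qed
  have step: "dist (x (Suc m * T)) (x (m * T)) \<le> Q m - Q (Suc m)"
    if m: "M' \<le> m" and ball: "dist (x (m * T)) xs < \<rho>'" for m
  proof -
    have "a (Suc m) \<le> a m / 2 + (a m + a (m - 1) + rate ^ m) / 8 + 2 * D * (\<Phi> m - \<Phi> (Suc m))"
      using KLstep[OF m ball] a_nonneg[of m] a_nonneg[of "m - 1"] a_nonneg[of "Suc m"] rate D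
      by (intro window_length_recursion) auto
    moreover have "2 * D * (\<Phi> m - \<Phi> (Suc m)) = 2 * (D * \<Phi> m) - 2 * (D * \<Phi> (Suc m))"
      "8 * D * \<Phi> m = 8 * (D * \<Phi> m)" "8 * D * \<Phi> (Suc m) = 8 * (D * \<Phi> (Suc m))"
      by (simp_all add: right_diff_distrib)
    moreover have "\<tau> * rate ^ m = (1/2 + \<tau> * rate) * rate ^ m" using \<tau>(2) by simp
    then have "\<tau> * rate ^ m = rate ^ m / 2 + \<tau> * rate ^ Suc m" by (simp add: distrib_right mult.assoc)
    moreover have "A \<le> (3 * B + B' / 2 + X + t) - (3 * A + B / 2 + X' + t')"
      if "A \<le> B / 2 + (B + B' + R) / 8 + K" "K = 2 * P - 2 * P'" "X = 8 * P" "X' = 8 * P'"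
        "t = R / 2 + t'" for A B B' R K P P' X X' t t' :: real
      using that by (simp add: field_simps)
    ultimately have "a (Suc m) \<le> (3 * a m + a (m - 1) / 2 + 8 * D * \<Phi> m + \<tau> * rate ^ m)
        - (3 * a (Suc m) + a m / 2 + 8 * D * \<Phi> (Suc m) + \<tau> * rate ^ Suc m)"
      by blast
    then have "real T / sqrt l * a (Suc m) \<le> real T / sqrt l *
        ((3 * a m + a (m - 1) / 2 + 8 * D * \<Phi> m + \<tau> * rate ^ m)
        - (3 * a (Suc m) + a m / 2 + 8 * D * \<Phi> (Suc m) + \<tau> * rate ^ Suc m))"
      using l_pos by (intro mult_left_mono) auto
    also have "\<dots> = Q m - Q (Suc m)" by (simp only: Q_def right_diff_distrib diff_Suc_1)
    finally have "real T / sqrt l * a (Suc m) \<le> Q m - Q (Suc m)" .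
    moreover have "norm (x (Suc m * T) - x (m * T)) \<le> real T * (a (Suc m) / sqrt l)"
      by (intro norm_diff_le_a) (auto simp: window_Suc)
    ultimately show ?thesis by (simp add: dist_norm)
  qed
  have "g \<longlonglongrightarrow> 0"
    unfolding g_def
    by (rule filterlim_compose[OF gap0 filterlim_subseq]) (use T_pos in \<open>simp add: strict_mono_def\<close>)
  moreover have "eventually (\<lambda>m. g m \<in> ?A) sequentially"
    using gA unfolding eventually_sequentially by blast
  ultimately have \<Phi>0: "\<Phi> \<longlonglongrightarrow> 0"
    using continuous_within_tendsto_compose[OF cont, of g] 
    by (simp add: \<Phi>_def[abs_def] \<phi>0)
  have "(\<lambda>m. a (Suc m - 1)) \<longlonglongrightarrow> 0" using a_tendsto_0 by simp
  then have a1: "(\<lambda>m. a (m - 1)) \<longlonglongrightarrow> 0" by (rule LIMSEQ_imp_Suc)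
  have "Q \<longlonglongrightarrow> real T / sqrt l * (3 * 0 + 0 / 2 + 8 * D * 0 + \<tau> * 0)"
    unfolding Q_def using rate by (intro tendsto_intros a_tendsto_0 a1 \<Phi>0 LIMSEQ_power_zero) auto
  then have Q0: "Q \<longlonglongrightarrow> 0" by simp
  have Qnonneg: "0 \<le> Q m" if "M' \<le> m" for m
  proof -
    have "0 \<le> \<Phi> m" using nonneg[of "g m"] gA[OF that] by (simp add: \<Phi>_def)
    then show ?thesis
      unfolding Q_def using a_nonneg[of m] a_nonneg[of "m - 1"] D \<tau> rate l_pos by simp
  qed
  have window_starts: "(\<lambda>m. x (m * T)) \<longlonglongrightarrow> xs"
  proof (rule trapped_near_limit_point[OF \<rho>' _ Qnonneg Q0])
    show "filterlim (\<lambda>k. r k div T) at_top sequentially"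
      by (rule filterlim_compose[OF filterlim_div_T filterlim_subseq[OF r(1)]])
    have "(\<lambda>k. x (r k) - x (r k div T * T)) \<longlonglongrightarrow> 0"
      by (rule filterlim_compose[OF iterate_minus_window_start_tendsto_0 filterlim_subseq[OF r(1)]])
    then show "(\<lambda>k. x (r k div T * T)) \<longlonglongrightarrow> xs"
      by (rule Lim_transform2[OF r(2)[unfolded o_def]])
  qed (use step in auto)
  then have "(\<lambda>k. x (k div T * T)) \<longlonglongrightarrow> xs"
    by (rule filterlim_compose[OF _ filterlim_div_T])
  then show ?thesis
    by (rule Lim_transform[OF _ iterate_minus_window_start_tendsto_0])
qed

end


section \<open>The convergence theorem\<close>

text \<open>
  It remains to translate the bound on the extrapolation parameters from the enumeration of the
  updates of a block to consecutive updates, and to replace the Lipschitz constants of the partial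
  gradients by one constant for all coordinates.
\<close>

theorem theorem4p4:
  fixes f :: "real ^ 'n::finite \<Rightarrow> real"
    and gradf :: "real ^ 'n \<Rightarrow> real ^ 'n"
    and S :: "'n set set"
    and p lam l L \<mu> \<delta> \<rho> :: real
    and T :: nat
    and b :: "nat \<Rightarrow> 'n set"
    and x eps :: "nat \<Rightarrow> real ^ 'n"
    and \<alpha> \<beta> Lip :: "nat \<Rightarrow> real"
    and Lip0 :: "'n set \<Rightarrow> real"
    and Lt \<beta>t :: "'n set \<Rightarrow> nat \<Rightarrow> real"
    and xs :: "real ^ 'n"
  assumes blocks: "partition_on UNIV S"
    and p: "0 < p" "p < 1"
    and lam: "0 < lam"
    (* Assumption 1 *)
    and f_grad: "\<And>z. GDERIV f z :> gradf z"
    and f_C1: "continuous_on UNIV gradf"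
    and l_L: "0 < l" "l \<le> L"
    and block_lipschitz: "\<And>s z. s \<in> S \<Longrightarrow>
          \<exists>K\<in>{l..L}. K-lipschitz_on (coord_space s)
                        (\<lambda>y. block_part s (gradf (replace_block z s y)))"
    and coercive: "\<And>e. filterlim (\<lambda>z. smoothed_obj f lam p z e) at_top at_infinity"
    (* the algorithm *)
    and mu: "0 < \<mu>" "\<mu> < 1"
    and eps0: "\<And>i. 0 < eps 0 $ i"
    and b_block: "\<And>k. 1 \<le> k \<Longrightarrow> b k \<in> S"
    and x_keep: "\<And>k i. 1 \<le> k \<Longrightarrow> i \<notin> b k \<Longrightarrow> x k $ i = x (k - 1) $ i"
    and x_update: "\<And>k. 1 \<le> k \<Longrightarrow>
          is_arg_min (block_model gradf lam p b \<alpha> \<beta> x eps k) (\<lambda>y. y \<in> coord_space (b k))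
            (block_part (b k) (x k))"
    and beta_range: "\<And>k. 1 \<le> k \<Longrightarrow> 0 \<le> \<beta> k \<and> \<beta> k \<le> 1"
    and eps_keep: "\<And>k i. x (k + 1) $ i = 0 \<Longrightarrow> eps (k + 1) $ i = eps k $ i"
    and eps_shrink: "\<And>k i. x (k + 1) $ i \<noteq> 0 \<Longrightarrow>
          0 < eps (k + 1) $ i \<and> eps (k + 1) $ i \<le> sqrt \<mu> * eps k $ i"
    (* parameters *)
    and Lip_range: "\<And>k. 1 \<le> k \<Longrightarrow> Lip k \<in> {l..L}"
    and Lip_lipschitz: "\<And>k. 1 \<le> k \<Longrightarrow>
          (Lip k)-lipschitz_on (coord_space (b k))
             (\<lambda>y. block_part (b k) (gradf (replace_block (x (k - 1)) (b k) y)))"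
    and Lip0_range: "\<And>s. s \<in> S \<Longrightarrow> Lip0 s \<in> {l..L}"
    and Lt_def: "\<And>s j. Lt s j = (if j = 0 then Lip0 s else Lip (update_iter b s j))"
    and \<beta>t_def: "\<And>s j. 1 \<le> j \<Longrightarrow> \<beta>t s j = \<beta> (update_iter b s j)"
    and alpha: "\<And>k. 1 \<le> k \<Longrightarrow> \<alpha> k = 1 / (2 * Lip k)"
    and delta: "0 \<le> \<delta>" "\<delta> < 1"
    and beta_bound: "\<And>s j. s \<in> S \<Longrightarrow> 1 \<le> j \<Longrightarrow>
          \<beta>t s j \<le> \<delta> / 6 * sqrt (Lt s (j - 1) / Lt s j)"
    (* Assumption 2 *)
    and T_ge: "card S \<le> T"
    and cyclic: "\<And>s k. s \<in> S \<Longrightarrow> 1 \<le> k \<Longrightarrow> \<exists>j\<in>{k..<k + T}. b j = s"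
    (* Assumption 3 *)
    and monotone_obj: "\<And>k. 1 \<le> k \<Longrightarrow>
          smoothed_obj f lam p (x k) (eps k) \<le> smoothed_obj f lam p (x (k - 1)) (eps (k - 1))"
    (* Assumption 4 *)
    and KL: "\<And>a. seq_limit_point x a \<Longrightarrow>
          KL_property (coord_space (eventual_support x) \<times> coord_space (eventual_support x))
            (\<lambda>z. ereal (reduced_obj f lam p (eventual_support x) z))
            (block_part (eventual_support x) a, 0)"
    (* limit point with locally Lipschitz partial gradients *)
    and limit_point: "seq_limit_point x xs"
    and rho: "0 < \<rho>"
    and local_lipschitz: "\<And>s. s \<in> S \<Longrightarrow>
          \<exists>LG. \<forall>y\<in>ball xs (4 * \<rho>). \<forall>z\<in>ball xs (4 * \<rho>).
             norm (block_part s (gradf y) - block_part s (gradf z)) \<le> LG * norm (y - z)"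
  shows "x \<longlonglongrightarrow> xs"
proof -
  have inf: "infinite {k. 1 \<le> k \<and> b k = s}" if s: "s \<in> S" for s
    unfolding infinite_nat_iff_unbounded_le
  proof
    fix m
    obtain j where "j \<in> {Suc m..<Suc m + T}" "b j = s" using cyclic[OF s, of "Suc m"] by auto
    then show "\<exists>n\<ge>m. n \<in> {k. 1 \<le> k \<and> b k = s}" by (intro exI[of _ j]) auto
  qed
  interpret extrapolated_block_descent f gradf S p lam l L \<mu> T b x eps \<alpha> \<beta> Lip
  proof
    fix k assume k: "1 \<le> last_update b k" "1 \<le> k"
    obtain j where j: "1 \<le> j" "update_iter b (b k) j = last_update b k" "update_iter b (b k) (Suc j) = k"
      using update_iter_successive[OF inf[OF b_block[OF k(2)]] k(2) refl k(1)] by blast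
    let ?q = "sqrt (Lip (last_update b k) / Lip k)"
    have "\<beta> k \<le> \<delta> / 6 * ?q"
      using beta_bound[OF b_block[OF k(2)], of "Suc j"] j by (simp add: \<beta>t_def Lt_def)
    also have "\<dots> \<le> 1 / 6 * ?q"
      using delta Lip_range[OF k(1)] Lip_range[OF k(2)] l_L by (intro mult_right_mono) auto
    finally show "\<beta> k \<le> 1 / 6 * ?q" .
  qed (fact assms)+
  have "\<exists>LG. \<forall>y\<in>ball xs (4 * \<rho>). \<forall>z\<in>ball xs (4 * \<rho>). \<bar>gradf y $ i - gradf z $ i\<bar> \<le> LG * norm (y - z)" for i
  proof -
    have "\<Union>S = UNIV" using assms(1) by (simp add: partition_on_def)
    then obtain s where s: "s \<in> S" "i \<in> s" by (metis UNIV_I UnionE)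
    obtain LG where LG: "\<And>y z. y \<in> ball xs (4 * \<rho>) \<Longrightarrow> z \<in> ball xs (4 * \<rho>) \<Longrightarrow>
        norm (block_part s (gradf y) - block_part s (gradf z)) \<le> LG * norm (y - z)"
      using local_lipschitz[OF s(1)] by blast
    have "\<bar>gradf y $ i - gradf z $ i\<bar> \<le> norm (block_part s (gradf y) - block_part s (gradf z))" for y z
      using component_le_norm_cart[of "block_part s (gradf y) - block_part s (gradf z)" i] s(2) by simp
    then show ?thesis using LG by (blast intro: order_trans)
  qed
  then obtain LG where LG: "\<And>i y z. y \<in> ball xs (4 * \<rho>) \<Longrightarrow> z \<in> ball xs (4 * \<rho>) \<Longrightarrow>
      \<bar>gradf y $ i - gradf z $ i\<bar> \<le> LG i * norm (y - z)"
    by metis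
  define LG' where "LG' = (\<Sum>i\<in>UNIV. \<bar>LG i\<bar>)"
  have "\<bar>LG i\<bar> \<le> LG'" for i unfolding LG'_def by (intro member_le_sum) auto
  then have LG'_ge: "LG i \<le> LG'" for i by (meson abs_ge_self order_trans)
  show ?thesis
  proof (rule iterates_converge[OF limit_point KL[OF limit_point] rho])
    show "0 \<le> LG'" by (simp add: LG'_def sum_nonneg)
    fix y z i assume "y \<in> ball xs (4 * \<rho>)" "z \<in> ball xs (4 * \<rho>)"
    then have "\<bar>gradf y $ i - gradf z $ i\<bar> \<le> LG i * norm (y - z)" by (rule LG)
    also have "\<dots> \<le> LG' * norm (y - z)" using LG'_ge by (intro mult_right_mono) auto
    finally show "\<bar>gradf y $ i - gradf z $ i\<bar> \<le> LG' * norm (y - z)" .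
  qed
qed

end
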